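(* Let $N\geq 2$ and let $\Gamma_\delta$ be a finite compact metric star graph with exactly $N+1$ vertices $V_1,\dots,V_{N+1}$, whose only internal vertex is $V_{N+1}$: it has $N$ edges of lengths $l_1,\dots,l_N$, the edge of length $l_i$ joining $V_i$ to $V_{N+1}$. Assume that $l_1,\dots,l_N$ are rationally independent and that all vertices are of $\delta$ type. Let $A_{\vec\alpha}$ and $A_{\vec{\widetilde\alpha}}$ be two graph Laplacians on $\Gamma_\delta$ with coupling constants $\vec\alpha,\vec{\widetilde\alpha}\in\mathbb R^{N+1}$; if $N=2$, assume in addition that the coupling constants at the internal vertex are non-zero. If the spectra of $A_{\vec\alpha}$ and $A_{\vec{\widetilde\alpha}}$ coincide counting multiplicities, then $\vec\alpha=\vec{\widetilde\alpha}$.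
   Context: A finite compact metric graph $\Gamma$ consists of finitely many compact intervals (edges) $\Delta_j=[x_{2j-1},x_{2j}]$ together with a partition of the set of endpoints into classes $V_1,V_2,\dots$ (vertices). The valence $\gamma_k=\deg V_k$ is the number of endpoints belonging to $V_k$; a vertex is internal if its valence is greater than 1. Put $L_2(\Gamma)=\bigoplus_j L_2(\Delta_j)$, $W_2^2(\Gamma)=\bigoplus_j W_2^2(\Delta_j)$. The normal derivative of $f\in W_2^2(\Gamma)$ at an endpoint is $\partial_n f(x_j)=f'(x_j)$ if $x_j$ is the left endpoint of its edge and $-f'(x_j)$ if it is the right endpoint. When all vertices are of $\delta$ type and $\vec\alpha$ is a vector of real coupling constants (one constant $\alpha_k$ for each vertex $V_k$), the graph Laplacian $A_{\vec\alpha}$ is the self-adjoint operator in $L_2(\Gamma)$ acting on each edge as $-\frac{d^2}{dx^2}$, on the domain of all $f\in W_2^2(\Gamma)$ that are continuous at every vertex (i.e. $f(x_i)=f(x_j)=:f(V_k)$ for all $x_i,x_j\in V_k$) and satisfy $\sum_{x_j\in V_k}\partial_n f(x_j)=\alpha_k f(V_k)$ for every $k$. Its spectrum is purely discrete. Edge lengths are called rationally independent if they are linearly independent over $\mathbb Q$. *)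

theory Defs
  imports "HOL-Analysis.Analysis" "HOL-Library.Function_Algebras" "HOL-Library.Disjoint_Sets"
begin

section \<open>Finite compact metric graphs\<close>

text \<open>
  The endpoints $x_1, \dots, x_{2n}$ of the $n$ edges are handled through their indices
  \<open>1, \<dots>, 2 * n\<close>, so that different edges are different copies of intervals even if these
  overlap on the real line; a vertex is a set of endpoint indices.  Edge \<open>j\<close> has the left
  endpoint of index \<open>2 * j - 1\<close> and the right endpoint of index \<open>2 * j\<close>.
\<close>

record metric_graph =
  num_edges :: nat
  endpoint :: "nat \<Rightarrow> real"
  num_verts :: nat
  vertex :: "nat \<Rightarrow> nat set"

definition edge :: "metric_graph \<Rightarrow> nat \<Rightarrow> real set" where
  "edge G j = {endpoint G (2 * j - 1) .. endpoint G (2 * j)}"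

definition edge_length :: "metric_graph \<Rightarrow> nat \<Rightarrow> real" where
  "edge_length G j = endpoint G (2 * j) - endpoint G (2 * j - 1)"

definition compact_metric_graph :: "metric_graph \<Rightarrow> bool" where
  "compact_metric_graph G \<longleftrightarrow>
     (\<forall>j\<in>{1..num_edges G}. endpoint G (2 * j - 1) < endpoint G (2 * j)) \<and>
     partition_on {1..2 * num_edges G} (vertex G ` {1..num_verts G}) \<and>
     inj_on (vertex G) {1..num_verts G}"

definition valence :: "metric_graph \<Rightarrow> nat \<Rightarrow> nat" where
  "valence G k = card (vertex G k)"

definition internal_vertex :: "metric_graph \<Rightarrow> nat \<Rightarrow> bool" where
  "internal_vertex G k \<longleftrightarrow> valence G k > 1"

definition edge_joins :: "metric_graph \<Rightarrow> nat \<Rightarrow> nat \<Rightarrow> nat \<Rightarrow> bool" where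
  "edge_joins G j k k' \<longleftrightarrow>
     (2 * j - 1 \<in> vertex G k \<and> 2 * j \<in> vertex G k') \<or>
     (2 * j \<in> vertex G k \<and> 2 * j - 1 \<in> vertex G k')"

definition star_graph :: "nat \<Rightarrow> (nat \<Rightarrow> real) \<Rightarrow> metric_graph \<Rightarrow> bool" where
  "star_graph N l G \<longleftrightarrow>
     compact_metric_graph G \<and> num_edges G = N \<and> num_verts G = N + 1 \<and>
     (\<forall>k\<in>{1..N + 1}. internal_vertex G k \<longleftrightarrow> k = N + 1) \<and>
     (\<forall>i\<in>{1..N}. edge_length G i = l i \<and> edge_joins G i i (N + 1))"

definition rationally_independent :: "nat set \<Rightarrow> (nat \<Rightarrow> real) \<Rightarrow> bool" where
  "rationally_independent I l \<longleftrightarrow>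
     (\<forall>c :: nat \<Rightarrow> rat. (\<Sum>i\<in>I. of_rat (c i) * l i) = 0 \<longrightarrow> (\<forall>i\<in>I. c i = 0))"


section \<open>The spaces $L_2$ and $W_2^2$\<close>

text \<open>A function on a graph is given by its restrictions \<open>f j\<close> to the edges.\<close>

type_synonym graph_fun = "nat \<Rightarrow> real \<Rightarrow> complex"

definition L2 :: "metric_graph \<Rightarrow> graph_fun set" where
  "L2 G = {f. \<forall>j\<in>{1..num_edges G}.
     f j \<in> borel_measurable (lebesgue_on (edge G j)) \<and>
     integrable (lebesgue_on (edge G j)) (\<lambda>x. (cmod (f j x))\<^sup>2)}"

definition L2_norm :: "metric_graph \<Rightarrow> graph_fun \<Rightarrow> real" where
  "L2_norm G f =
     sqrt (\<Sum>j\<in>{1..num_edges G}. \<integral>x. (cmod (f j x))\<^sup>2 \<partial>lebesgue_on (edge G j))"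

definition edge_deriv :: "metric_graph \<Rightarrow> graph_fun \<Rightarrow> graph_fun" where
  "edge_deriv G f j x = vector_derivative (f j) (at x within edge G j)"

text \<open>
  \<open>has_second_deriv G f g\<close>: on every edge \<open>f\<close> is differentiable, \<open>f'\<close> is absolutely continuous,
  and \<open>g\<close> is a function in $L_2$ with \<open>f'' = g\<close> almost everywhere.  Absolute continuity is
  expressed by \<open>f'\<close> being an indefinite integral of \<open>g\<close>.
\<close>

definition has_second_deriv :: "metric_graph \<Rightarrow> graph_fun \<Rightarrow> graph_fun \<Rightarrow> bool" where
  "has_second_deriv G f g \<longleftrightarrow> g \<in> L2 G \<and>
     (\<forall>j\<in>{1..num_edges G}. f j differentiable_on edge G j \<and>
        (\<forall>x\<in>edge G j.
           (g j has_integral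
              (edge_deriv G f j x - edge_deriv G f j (endpoint G (2 * j - 1))))
           {endpoint G (2 * j - 1)..x}))"

text \<open>
  Elements of $W_2^2$ are represented by their continuously differentiable representatives.
  Requiring them to vanish off the edges makes this representation unique, so that equality
  and linear independence in $W_2^2$ are those of HOL functions.
\<close>

definition W22 :: "metric_graph \<Rightarrow> graph_fun set" where
  "W22 G = {f. (\<forall>j x. f j x \<noteq> 0 \<longrightarrow> j \<in> {1..num_edges G} \<and> x \<in> edge G j) \<and>
              (\<exists>g. has_second_deriv G f g)}"


section \<open>The graph Laplacian with $\delta$ type vertices\<close>

text \<open>The endpoint of index \<open>i\<close> lies on the edge \<open>(i + 1) div 2\<close>.\<close>

definition endpoint_value :: "metric_graph \<Rightarrow> graph_fun \<Rightarrow> nat \<Rightarrow> complex" where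
  "endpoint_value G f i = f ((i + 1) div 2) (endpoint G i)"

definition normal_deriv :: "metric_graph \<Rightarrow> graph_fun \<Rightarrow> nat \<Rightarrow> complex" where
  "normal_deriv G f i =
     (if odd i then 1 else -1) * edge_deriv G f ((i + 1) div 2) (endpoint G i)"

definition laplacian_domain :: "metric_graph \<Rightarrow> (nat \<Rightarrow> real) \<Rightarrow> graph_fun set" where
  "laplacian_domain G \<alpha> = {f \<in> W22 G. \<forall>k\<in>{1..num_verts G}.
     (\<forall>i\<in>vertex G k. \<forall>i'\<in>vertex G k. endpoint_value G f i = endpoint_value G f i') \<and>
     (\<forall>i\<in>vertex G k.
        (\<Sum>i'\<in>vertex G k. normal_deriv G f i') = of_real (\<alpha> k) * endpoint_value G f i)}"

text \<open>
  The operator is given by its graph: \<open>(f, h)\<close> belongs to it iff \<open>f\<close> is in the domain and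
  \<open>h\<close> is any representative of the class of \<open>-f''\<close> in $L_2$.
\<close>

definition laplacian :: "metric_graph \<Rightarrow> (nat \<Rightarrow> real) \<Rightarrow> (graph_fun \<times> graph_fun) set" where
  "laplacian G \<alpha> =
     {(f, h). f \<in> laplacian_domain G \<alpha> \<and> has_second_deriv G f (\<lambda>j x. - h j x)}"


section \<open>Spectrum and multiplicities\<close>

text \<open>
  \<open>(f, z f + g) \<in> A\<close> says \<open>(A - z) f = g\<close> almost everywhere.  Thus \<open>z\<close> is in the resolvent set iff
  \<open>A - z\<close> is a bijection from the domain onto $L_2$ with bounded inverse.
\<close>

definition resolvent_set ::
    "metric_graph \<Rightarrow> (graph_fun \<times> graph_fun) set \<Rightarrow> complex set" where
  "resolvent_set G A = {z.
     (\<forall>g\<in>L2 G. \<exists>!f. (f, \<lambda>j x. z * f j x + g j x) \<in> A) \<and>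
     (\<exists>C. \<forall>g\<in>L2 G. \<forall>f. (f, \<lambda>j x. z * f j x + g j x) \<in> A \<longrightarrow>
        L2_norm G f \<le> C * L2_norm G g)}"

definition spectrum :: "metric_graph \<Rightarrow> (graph_fun \<times> graph_fun) set \<Rightarrow> complex set" where
  "spectrum G A = - resolvent_set G A"

definition graph_fun_scale :: "complex \<Rightarrow> graph_fun \<Rightarrow> graph_fun" where
  "graph_fun_scale c f = (\<lambda>j x. c * f j x)"

lemma vector_space_graph_fun: "vector_space graph_fun_scale"
  by unfold_locales (simp_all add: graph_fun_scale_def plus_fun_def algebra_simps)

definition eigenspace :: "(graph_fun \<times> graph_fun) set \<Rightarrow> complex \<Rightarrow> graph_fun set" where
  "eigenspace A z = {f. (f, graph_fun_scale z f) \<in> A}"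

definition multiplicity :: "(graph_fun \<times> graph_fun) set \<Rightarrow> complex \<Rightarrow> nat" where
  "multiplicity A z = vector_space.dim graph_fun_scale (eigenspace A z)"

text \<open>
  For operators with purely discrete spectrum, where every point of the spectrum is an
  eigenvalue of finite multiplicity, this is coincidence of the spectra counting multiplicities.
\<close>

definition isospectral ::
    "metric_graph \<Rightarrow> (graph_fun \<times> graph_fun) set \<Rightarrow> (graph_fun \<times> graph_fun) set \<Rightarrow> bool" where
  "isospectral G A B \<longleftrightarrow>
     spectrum G A = spectrum G B \<and> (\<forall>z\<in>spectrum G A. multiplicity A z = multiplicity B z)"

end

theory Submission
  imports Defs
begin

text \<open>
Let \<open>k > 0\<close>.  Measured by the distance $s$ from the boundary vertex $V_i$, the solutions of
$-u'' = k^2 u$ on edge $i$ that satisfy the $\delta$ condition at $V_i$ are the multiples of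
$\cos (k s - \arctan (\alpha_i / k))$.  At the centre such a wave is seen through its phase
$k l_i - \arctan (\alpha_i / k)$ only.  As long as no cosine of a phase vanishes, continuity at the
centre determines the waves up to one common factor, and the condition on their derivatives
becomes the secular equation
\[ \sum_{i=1}^N \tan \bigl(k l_i - \arctan (\alpha_i / k)\bigr) = \alpha_{N+1} / k. \]
So \<open>k\<^sup>2\<close> is a simple eigenvalue or none according to whether \<open>k\<close> solves this equation
(\<open>eigenfunction_eq_scaled_star_mode\<close>, \<open>scaled_star_mode_in_eigenspace\<close>), and isospectral operators
share these solutions (\<open>isospectral_shares_secular_solutions\<close>).

It remains to recover the constants from the large solutions.  By Kronecker's theorem, rational
independence of the lengths makes the vector of the $k l_i$ modulo $\pi$ come close to any
prescribed point at arbitrarily large \<open>k\<close>.  As the sum of the tangents is increasing along the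
flow in \<open>k\<close>, and the constants have an influence of order $1/k$ only, there are solutions
$k \to \infty$ along which the tangents tend to any prescribed $\tau \in \mathbb R^N$ with
$\sum_i \tau_i = 0$ (\<open>secular_solution_near\<close>).

Along them, put $\beta = \alpha - \alpha'$.  Replacing $\alpha$ by $\alpha'$ changes the $i$-th tangent by
$\beta_i (1 + \tau_i^2) / k + o(1/k)$.  Subtracting the two secular equations therefore gives
$\sum_{i \le N} \beta_i (1 + \tau_i^2) = - \beta_{N+1}$ (\<open>shared_first_order\<close>).  From \<open>\<tau> = 0\<close> and from
the vectors $\tau$ with entries $1$ and $-1$ at two edges and $0$ elsewhere one obtains
$\beta_i + \beta_j = 0$ for all $i \neq j$, hence $\beta = 0$ if $N \ge 3$.  For $N = 2$ the case
$\beta_1 = - \beta_2$ and $\beta_3 = 0$ survives; it is excluded by the next order of the expansion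
if $\alpha_3 \neq 0$ (\<open>shared_second_order\<close>).  If $\alpha_3 = 0$, this case does occur: the star is then
an interval, and reflecting it exchanges $\alpha_1$ and $\alpha_2$.
\<close>

section \<open>Simultaneous approximation\<close>

lemma rationally_independent_inj_on:
  assumes "rationally_independent I l" "finite I"
  shows "inj_on l I"
proof (rule inj_onI, rule ccontr)
  fix i j assume ij: "i \<in> I" "j \<in> I" "l i = l j" "i \<noteq> j"
  define c :: "nat \<Rightarrow> rat" where "c x = (if x = i then 1 else if x = j then - 1 else 0)" for x
  have "(\<Sum>x\<in>I. of_rat (c x) * l x)
        = (\<Sum>x\<in>I. (if x = i then l i else 0) + (if x = j then - l j else 0))"
    using ij(4) by (intro sum.cong) (auto simp: c_def)
  also have "\<dots> = 0" using ij assms(2) by (simp add: sum.distrib)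
  finally have "c i = 0" using assms(1) ij(1) unfolding rationally_independent_def by blast
  then show False by (simp add: c_def)
qed

text \<open>
The factor \<open>s\<close> allows for measuring the lengths in units of \<open>pi\<close>.
\<close>

lemma rationally_independent_imp_independent:
  assumes "rationally_independent I l" "finite I" "s \<noteq> (0::real)"
  shows "module.independent (\<lambda>r. (*) (real_of_int r)) ((\<lambda>i. s * l i) ` I)"
proof -
  interpret Modules.module "(\<lambda>r. (*) (real_of_int r))"
    by (simp add: Modules.module.intro distrib_left mult.commute)
  have inj: "inj_on (\<lambda>i. s * l i) I"
    using rationally_independent_inj_on[OF assms(1,2)] assms(3) by (simp add: inj_on_def)
  show ?thesis
  proof
    assume "dependent ((\<lambda>i. s * l i) ` I)"
    then obtain u :: "real \<Rightarrow> int" and i where i: "i \<in> I" "u (s * l i) \<noteq> 0"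
      and "(\<Sum>v\<in>(\<lambda>i. s * l i) ` I. real_of_int (u v) * v) = 0"
      using assms(2) by (auto simp: dependent_finite)
    then have "s * (\<Sum>i\<in>I. of_rat (of_int (u (s * l i))) * l i) = 0"
      by (simp add: sum.reindex[OF inj] sum_distrib_left algebra_simps)
    then have "(\<Sum>i\<in>I. of_rat (of_int (u (s * l i))) * l i) = 0"
      using assms(3) by simp
    then have "(of_int (u (s * l i)) :: rat) = 0"
      using assms(1)[unfolded rationally_independent_def,
          rule_format, of "\<lambda>i. of_int (u (s * l i))"] i(1) by blast
    with i(2) show False by simp
  qed
qed

text \<open>
Kronecker's theorem yields some real \<open>t\<close>, which may be small or negative.  Adding a large
number whose products with all \<open>l j\<close> are close to \<open>pi * \<int>\<close> repairs this and worsens the approximation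
by an arbitrarily small amount.  Dirichlet's theorem, applied to the multiples of a large \<open>M\<close>, provides
such a number.
\<close>

lemma Kronecker_arbitrarily_large:
  assumes "rationally_independent {1..N} l" "\<epsilon> > 0"
  shows "\<exists>t>K. \<exists>h :: nat \<Rightarrow> int. \<forall>j\<in>{1..N}. \<bar>t * l j - pi * h j - \<theta> j\<bar> < \<epsilon>"
proof -
  have "{1..N} = Suc ` {..<N}" by (simp only: image_Suc_lessThan)
  then have im: "(\<lambda>i. l (Suc i) / pi) ` {..<N} = (\<lambda>i. 1 / pi * l i) ` {1..N}"
    by (simp only: image_image times_divide_eq_left mult.left_neutral)
  have ind: "module.independent (\<lambda>r. (*) (real_of_int r)) ((\<lambda>i. l (Suc i) / pi) ` {..<N})"
    unfolding im by (rule rationally_independent_imp_independent[OF assms(1)]) simp_all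
  have inj: "inj_on (\<lambda>i. l (Suc i) / pi) {..<N}"
  proof (rule inj_onI)
    fix x y assume "x \<in> {..<N}" "y \<in> {..<N}" "l (Suc x) / pi = l (Suc y) / pi"
    then show "x = y"
      using inj_onD[OF rationally_independent_inj_on[OF assms(1)], of "Suc x" "Suc y"] by simp
  qed
  define \<eta> where "\<eta> = \<epsilon> / (2 * pi)"
  have \<eta>: "\<eta> > 0" using assms(2) by (simp add: \<eta>_def)
  obtain t h where t: "\<And>i. i < N \<Longrightarrow> \<bar>t * (l (Suc i) / pi) - of_int (h i) - \<theta> (Suc i) / pi\<bar> < \<eta>"
    by (rule Kronecker_thm_1[OF ind inj \<eta>, where \<alpha> = "\<lambda>i. \<theta> (Suc i) / pi"]) (rule that)
  define M where "M = max 1 (K - t + 1)"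
  obtain m :: nat where m: "m > 0" "1 / m < \<eta>"
    using real_arch_inverse[of \<eta>] \<eta> by (auto simp: inverse_eq_divide)
  obtain q p where q: "0 < q" and p: "\<And>i. i < N \<Longrightarrow> \<bar>of_int q * (M * l (Suc i) / pi) - of_int (p i)\<bar> < 1 / m"
    by (rule Dirichlet_approx_simult[OF m(1), where n = N and \<theta> = "\<lambda>i. M * l (Suc i) / pi"]) (rule that)
  have M: "M \<ge> 1" "K < t + M" by (auto simp: M_def)
  note M(2)
  also have "t + M \<le> t + q * M"
    using mult_right_mono[of 1 "real_of_int q" M] q M(1) by simp
  finally have large: "t + q * M > K" .
  have "\<bar>(t + q * M) * l j - pi * of_int (h (j - 1) + p (j - 1)) - \<theta> j\<bar> < \<epsilon>" if j: "j \<in> {1..N}" for j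
  proof -
    obtain i where i: "j = Suc i" "i < N" using j by (cases j) auto
    define e where "e = (t + q * M) * (l j / pi) - (of_int (h i) + of_int (p i)) - \<theta> j / pi"
    have "e = (t * (l j / pi) - of_int (h i) - \<theta> j / pi) + (of_int q * (M * l j / pi) - of_int (p i))"
      by (simp add: e_def algebra_simps)
    moreover have "\<bar>t * (l j / pi) - of_int (h i) - \<theta> j / pi\<bar> < \<eta>" 
      "\<bar>of_int q * (M * l j / pi) - of_int (p i)\<bar> < 1 / m"
      using t[OF i(2)] p[OF i(2)] by (simp_all only: i(1))
    ultimately have "\<bar>e\<bar> < 2 * \<eta>" using m(2)
      abs_triangle_ineq[of "t * (l j / pi) - of_int (h i) - \<theta> j / pi"
        "of_int q * (M * l j / pi) - of_int (p i)"]
      by simp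
    then have "pi * \<bar>e\<bar> < pi * (2 * \<eta>)" by simp
    moreover have "pi * (2 * \<eta>) = \<epsilon>" by (simp add: \<eta>_def)
    moreover have "pi * \<bar>e\<bar> = \<bar>pi * e\<bar>" by (simp add: abs_mult)
    moreover have "pi * e = (t + q * M) * l j - pi * of_int (h (j - 1) + p (j - 1)) - \<theta> j"
      by (simp add: e_def i(1) right_diff_distrib)
    ultimately show ?thesis by simp
  qed
  then show ?thesis using large by (intro exI[of _ "t + q * M"] conjI exI[of _ "\<lambda>j. h (j - 1) + p (j - 1)"]) auto
qed

section \<open>Roots of the secular equation\<close>

text \<open>
The phase, modulo \<open>pi\<close>, with which a standing wave of wave number \<open>k\<close> arrives at the centre
after being reflected at the \<open>j\<close>-th boundary vertex; the coupling constant there shifts it by an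
arctangent, because $\cos (k s - \vartheta)$ has logarithmic derivative $k \tan \vartheta$ at
$s = 0$.
\<close>
definition phase :: "(nat \<Rightarrow> real) \<Rightarrow> (nat \<Rightarrow> real) \<Rightarrow> real \<Rightarrow> nat \<Rightarrow> real" where
  "phase l \<alpha> k j = k * l j - arctan (\<alpha> j / k)"

text \<open>
The condition on \<open>k\<close> that remains at the centre when a standing wave on the star does not vanish
there: divided by \<open>k\<close> and by the value at the centre, the normal derivatives are the tangents of
the phases.
\<close>
definition secular_solution ::
    "nat \<Rightarrow> (nat \<Rightarrow> real) \<Rightarrow> (nat \<Rightarrow> real) \<Rightarrow> real \<Rightarrow> bool" where
  "secular_solution N l \<alpha> k \<longleftrightarrow> (\<Sum>j=1..N. tan (phase l \<alpha> k j)) = \<alpha> (N + 1) / k"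

lemma tan_minus_int_pi: "tan (x - pi * of_int n) = tan x"
  using tan_periodic_int[of x "- n"] by (simp add: mult.commute)

lemma cos_minus_int_pi_eq_0: "cos (x - pi * of_int n) = 0 \<longleftrightarrow> cos x = 0"
  by (simp add: cos_diff mult.commute)

lemma cos_neq_zero_pi: "cos x \<noteq> 0" if "\<bar>x\<bar> < pi / 2" for x :: real
proof -
  have "- (pi / 2) < x" "x < pi / 2" using that by linarith+
  from cos_gt_zero_pi[OF this] show ?thesis by simp
qed

lemma LIMSEQ_of_less_inverse_Suc:
  assumes "\<And>n. \<bar>x n - L\<bar> < 1 / Suc n"
  shows "x \<longlonglongrightarrow> (L::real)"
proof -
  have lim: "(\<lambda>n. 1 / real (Suc n)) \<longlonglongrightarrow> 0"
    using LIMSEQ_inverse_real_of_nat by (simp only: inverse_eq_divide)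
  have *: "norm (x n - L) \<le> 1 / real (Suc n)" for n
    using assms[of n] by (simp only: real_norm_def less_imp_le)
  have "(\<lambda>n. x n - L) \<longlonglongrightarrow> 0"
    by (rule Lim_null_comparison[OF always_eventually[OF allI[OF *]] lim])
  then show ?thesis by (simp add: LIM_zero_iff)
qed

text \<open>
The arguments \<open>\<theta> j = arctan (\<tau> j)\<close> solve the limiting equation, in which all coupling constants
are dropped.  Choose \<open>T\<close> large with \<open>T * l j\<close> close to \<open>\<theta> j\<close> modulo \<open>pi\<close>.  For \<open>k = T + s\<close> with
\<open>s\<close> in a short interval around 0, the phases are close to \<open>\<theta> j + s * l j\<close>, and the sum of the
tangents of the latter increases strictly in \<open>s\<close> and vanishes at \<open>s = 0\<close>.  The coupling
constants perturb this only by terms that tend to 0 as \<open>T\<close> grows, so there is still a sign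
change, and the intermediate value theorem gives a root.
\<close>

lemma secular_solution_near:
  assumes ri: "rationally_independent {1..N} l" and l: "\<And>j. j \<in> {1..N} \<Longrightarrow> l j > 0"
    and N: "N \<ge> 1" and \<tau>: "(\<Sum>j=1..N. \<tau> j) = 0" and \<epsilon>: "\<epsilon> > 0"
  shows "\<exists>k>K. k > 0 \<and> secular_solution N l \<alpha> k \<and>
     (\<forall>j\<in>{1..N}. cos (phase l \<alpha> k j) \<noteq> 0 \<and> \<bar>tan (phase l \<alpha> k j) - \<tau> j\<bar> < \<epsilon>)"
proof -
  define \<theta> where "\<theta> j = arctan (\<tau> j)" for j
  have \<theta>: "\<bar>\<theta> j\<bar> < pi / 2" "tan (\<theta> j) = \<tau> j" for j
    using arctan_bounded[of "\<tau> j"] by (auto simp: \<theta>_def tan_arctan abs_less_iff)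
  have ne: "{1..N} \<noteq> {}" using N by auto
  have "\<exists>\<rho>>0. \<forall>y. \<bar>y - \<theta> j\<bar> < \<rho> \<longrightarrow> \<bar>y\<bar> < pi / 2 \<and> \<bar>tan y - \<tau> j\<bar> < \<epsilon>" for j
  proof -
    have "cos (\<theta> j) > 0" using \<theta>(1)[of j] by (simp add: cos_gt_zero_pi abs_less_iff)
    then have "isCont tan (\<theta> j)" by (intro isCont_tan) auto
    then have "tan \<midarrow>\<theta> j\<rightarrow> \<tau> j" unfolding isCont_def \<theta>(2) .
    then have "eventually (\<lambda>y. \<bar>tan y - \<tau> j\<bar> < \<epsilon>) (at (\<theta> j))"
      using \<epsilon> by (auto simp: tendsto_iff dist_real_def)
    then obtain d where d: "d > 0" "\<And>y. y \<noteq> \<theta> j \<Longrightarrow> \<bar>y - \<theta> j\<bar> < d \<Longrightarrow> \<bar>tan y - \<tau> j\<bar> < \<epsilon>"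
      by (auto simp: eventually_at dist_real_def)
    have d': "\<bar>tan y - \<tau> j\<bar> < \<epsilon>" if "\<bar>y - \<theta> j\<bar> < d" for y
      using d(2)[of y] \<theta>(2)[of j] \<epsilon> that by (cases "y = \<theta> j") auto
    show ?thesis
      using d(1) d' \<theta>(1)[of j] by (intro exI[of _ "min d (pi / 2 - \<bar>\<theta> j\<bar>)"]) auto
  qed
  then obtain \<rho>' where \<rho>': "\<And>j. \<rho>' j > 0"
    "\<And>j y. \<bar>y - \<theta> j\<bar> < \<rho>' j \<Longrightarrow> \<bar>y\<bar> < pi / 2 \<and> \<bar>tan y - \<tau> j\<bar> < \<epsilon>" by metis
  \<comment> \<open>Within distance \<open>\<rho>\<close> of \<open>\<theta> j\<close> the tangent has no pole and is \<open>\<epsilon>\<close>-close to \<open>\<tau> j\<close>.  This budget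
    is spent as follows: half on the motion of \<open>k\<close>, a quarter on the approximation of the lengths
    and a quarter on the shift by the coupling constants.\<close>
  define \<rho> where "\<rho> = Min (\<rho>' ` {1..N})"
  have \<rho>: "\<rho> > 0" "\<And>j y. j \<in> {1..N} \<Longrightarrow> \<bar>y - \<theta> j\<bar> < \<rho> \<Longrightarrow> \<bar>y\<bar> < pi / 2 \<and> \<bar>tan y - \<tau> j\<bar> < \<epsilon>"
  proof -
    show "\<rho> > 0" using \<rho>'(1) ne by (simp add: \<rho>_def)
    fix j y assume j: "j \<in> {1..N}" and y: "\<bar>y - \<theta> j\<bar> < \<rho>"
    have "\<rho> \<le> \<rho>' j" unfolding \<rho>_def using j by (intro Min_le) auto
    with y show "\<bar>y\<bar> < pi / 2 \<and> \<bar>tan y - \<tau> j\<bar> < \<epsilon>" using \<rho>'(2)[of y j] by simp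
  qed
  define r where "r = \<rho> / (2 * Max (l ` {1..N}))"
  have Max_l: "Max (l ` {1..N}) \<ge> l j" if "j \<in> {1..N}" for j using that by auto
  have Max_pos: "Max (l ` {1..N}) > 0"
  proof -
    have 1: "1 \<in> {1..N}" using N by simp
    show ?thesis using Max_l[OF 1] l[OF 1] by linarith
  qed
  have r: "r > 0" using \<rho>(1) Max_pos by (simp add: r_def)
  have rl: "r * l j \<le> \<rho> / 2" if "j \<in> {1..N}" for j
  proof -
    have "r * l j \<le> r * Max (l ` {1..N})" using Max_l[OF that] r by simp
    also have "\<dots> = \<rho> / 2" using Max_pos by (simp add: r_def)
    finally show ?thesis .
  qed
  have "\<exists>t h. t > real n \<and> (\<forall>j\<in>{1..N}. \<bar>t * l j - pi * of_int (h j) - \<theta> j\<bar> < 1 / Suc n)" for n :: nat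
  proof -
    have "(0::real) < 1 / Suc n" by simp
    from Kronecker_arbitrarily_large[OF ri this, where K = n and \<theta> = \<theta>]
    show ?thesis by blast
  qed
  then obtain T and h :: "nat \<Rightarrow> nat \<Rightarrow> int" where T: "\<And>n. T n > real n"
    and Th: "\<And>n j. j \<in> {1..N} \<Longrightarrow> \<bar>T n * l j - pi * of_int (h n j) - \<theta> j\<bar> < 1 / Suc n"
    by metis
  have T_top: "filterlim T at_top sequentially"
    by (intro filterlim_at_top_mono[OF filterlim_real_sequentially] always_eventually allI
        less_imp_le[OF T])
  have Th_lim: "(\<lambda>n. T n * l j - pi * of_int (h n j)) \<longlonglongrightarrow> \<theta> j" if "j \<in> {1..N}" for j
    by (rule LIMSEQ_of_less_inverse_Suc) (rule Th[OF that])
  define y where "y n s j = phase l \<alpha> (T n + s) j - pi * of_int (h n j)" for n s j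
  have tan_y: "tan (y n s j) = tan (phase l \<alpha> (T n + s) j)"
    and cos_y: "cos (y n s j) = 0 \<longleftrightarrow> cos (phase l \<alpha> (T n + s) j) = 0" for n s j
    by (simp_all add: y_def tan_minus_int_pi cos_minus_int_pi_eq_0)
  have shift_top: "filterlim (\<lambda>n. T n + s) at_top sequentially" for s
    using filterlim_tendsto_add_at_top[OF tendsto_const[of s] T_top] by (simp add: add.commute)
  have y_lim: "(\<lambda>n. y n s j) \<longlonglongrightarrow> \<theta> j + s * l j" if j: "j \<in> {1..N}" for s j
  proof -
    have "(\<lambda>n. arctan (\<alpha> j / (T n + s))) \<longlonglongrightarrow> arctan 0"
      by (intro tendsto_arctan real_tendsto_divide_at_top[OF tendsto_const shift_top])
    then have "(\<lambda>n. (T n * l j - pi * of_int (h n j)) + s * l j - arctan (\<alpha> j / (T n + s)))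
        \<longlonglongrightarrow> \<theta> j + s * l j - 0"
      by (intro tendsto_diff tendsto_add Th_lim[OF j] tendsto_const) simp
    then show ?thesis by (simp add: y_def phase_def algebra_simps)
  qed
  define g where "g k = (\<Sum>j=1..N. tan (phase l \<alpha> k j)) - \<alpha> (N + 1) / k" for k
  have g_lim: "(\<lambda>n. g (T n + s)) \<longlonglongrightarrow> (\<Sum>j=1..N. tan (\<theta> j + s * l j))" if s: "\<bar>s\<bar> \<le> r" for s
  proof -
    have "cos (\<theta> j + s * l j) \<noteq> 0" if j: "j \<in> {1..N}" for j
    proof -
      have "\<bar>s * l j\<bar> \<le> r * l j" using s l[OF j] by (simp add: abs_mult)
      then have "\<bar>\<theta> j + s * l j - \<theta> j\<bar> < \<rho>" using rl[OF j] \<rho>(1) by auto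
      then have "\<bar>\<theta> j + s * l j\<bar> < pi / 2" using \<rho>(2)[OF j] by blast
      then show ?thesis by (rule cos_neq_zero_pi)
    qed
    then have "(\<lambda>n. tan (y n s j)) \<longlonglongrightarrow> tan (\<theta> j + s * l j)" if "j \<in> {1..N}" for j
      using isCont_tendsto_compose[OF isCont_tan y_lim[OF that]] that by blast
    then have "(\<lambda>n. (\<Sum>j=1..N. tan (y n s j)) - \<alpha> (N + 1) / (T n + s))
        \<longlonglongrightarrow> (\<Sum>j=1..N. tan (\<theta> j + s * l j)) - 0"
      by (intro tendsto_diff tendsto_sum real_tendsto_divide_at_top[OF tendsto_const shift_top])
    then show ?thesis by (simp add: g_def tan_y)
  qed
  have mono: "tan (\<theta> j + s * l j) < tan (\<theta> j + s' * l j)"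
    if j: "j \<in> {1..N}" and s: "s < s'" "\<bar>s\<bar> \<le> r" "\<bar>s'\<bar> \<le> r" for j s s'
  proof -
    have *: "\<bar>\<theta> j + x * l j\<bar> < pi / 2" if x: "\<bar>x\<bar> \<le> r" for x
    proof -
      have "\<bar>x * l j\<bar> \<le> r * l j" using x l[OF j] by (simp add: abs_mult)
      then have "\<bar>\<theta> j + x * l j - \<theta> j\<bar> < \<rho>" using rl[OF j] \<rho>(1) by auto
      then show ?thesis using \<rho>(2)[OF j] by blast
    qed
    have "s * l j < s' * l j" using s(1) l[OF j] by simp
    then show ?thesis
      using *[OF s(2)] *[OF s(3)] by (intro tan_monotone) linarith+
  qed
  have sum0: "(\<Sum>j=1..N. tan (\<theta> j + 0 * l j)) = 0" using \<tau> by (simp add: \<theta>(2))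
  have pos: "(\<Sum>j=1..N. tan (\<theta> j + r * l j)) > 0"
    using sum_strict_mono[of "{1..N}" "\<lambda>j. tan (\<theta> j + 0 * l j)" "\<lambda>j. tan (\<theta> j + r * l j)"]
      mono[of _ 0 r] r ne sum0 by simp
  have neg: "(\<Sum>j=1..N. tan (\<theta> j + (- r) * l j)) < 0"
    using sum_strict_mono[of "{1..N}" "\<lambda>j. tan (\<theta> j + (- r) * l j)" "\<lambda>j. tan (\<theta> j + 0 * l j)"]
      mono[of _ "- r" 0] r ne sum0 by simp
  have ev1: "\<forall>\<^sub>F n in sequentially. g (T n + r) > 0"
    using order_tendstoD(1)[OF g_lim[of r] pos] r by simp
  have ev2: "\<forall>\<^sub>F n in sequentially. g (T n + (- r)) < 0"
    using order_tendstoD(2)[OF g_lim[of "- r"] neg] r by simp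
  have ev3: "\<forall>\<^sub>F n in sequentially. T n > max K 0 + r"
    using T_top by (simp add: filterlim_at_top_dense)
  have ev4: "\<forall>\<^sub>F n in sequentially. \<forall>j\<in>{1..N}. \<bar>T n * l j - pi * of_int (h n j) - \<theta> j\<bar> < \<rho> / 4"
  proof (intro eventually_ball_finite ballI)
    fix j assume "j \<in> {1..N}"
    from tendstoD[OF Th_lim[OF this], of "\<rho> / 4"] \<rho>(1)
    show "\<forall>\<^sub>F n in sequentially. \<bar>T n * l j - pi * of_int (h n j) - \<theta> j\<bar> < \<rho> / 4"
      by (simp add: dist_real_def)
  qed simp
  have ev5: "\<forall>\<^sub>F n in sequentially. \<forall>j\<in>{1..N}. \<bar>\<alpha> j\<bar> / (T n - r) < \<rho> / 4"
  proof (intro eventually_ball_finite ballI)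
    fix j
    have "(\<lambda>n. \<bar>\<alpha> j\<bar> / (T n + (- r))) \<longlonglongrightarrow> 0"
      by (intro real_tendsto_divide_at_top[OF tendsto_const shift_top])
    from order_tendstoD(2)[OF this, of "\<rho> / 4"] \<rho>(1)
    show "\<forall>\<^sub>F n in sequentially. \<bar>\<alpha> j\<bar> / (T n - r) < \<rho> / 4" by simp
  qed simp
  obtain n where n: "g (T n + r) > 0" "g (T n - r) < 0" "T n > max K 0 + r"
    "\<And>j. j \<in> {1..N} \<Longrightarrow> \<bar>T n * l j - pi * of_int (h n j) - \<theta> j\<bar> < \<rho> / 4"
    "\<And>j. j \<in> {1..N} \<Longrightarrow> \<bar>\<alpha> j\<bar> / (T n - r) < \<rho> / 4"
    using eventually_happens'[OF sequentially_bot
        eventually_conj[OF ev1 eventually_conj[OF ev2 eventually_conj[OF ev3 eventually_conj[OF ev4 ev5]]]]]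
    by auto
  have close: "\<bar>y n s j - \<theta> j\<bar> < \<rho>" if j: "j \<in> {1..N}" and s: "\<bar>s\<bar> \<le> r" for s j
  proof -
    have "\<bar>arctan (\<alpha> j / (T n + s))\<bar> \<le> \<bar>\<alpha> j / (T n + s)\<bar>" 
      by (rule abs_arctan_le)
    also have "\<dots> \<le> \<bar>\<alpha> j\<bar> / (T n - r)"
    proof -
      have "T n - r > 0" "T n - r \<le> \<bar>T n + s\<bar>" using n(3) s r by linarith+
      then show ?thesis unfolding abs_divide by (intro divide_left_mono mult_pos_pos) auto
    qed
    finally have 1: "\<bar>arctan (\<alpha> j / (T n + s))\<bar> < \<rho> / 4" using n(5)[OF j] by linarith
    have "\<bar>s * l j\<bar> \<le> r * l j" using s l[OF j] by (simp add: abs_mult)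
    then have 2: "\<bar>s * l j\<bar> \<le> \<rho> / 2" using rl[OF j] by simp
    have "y n s j - \<theta> j = (T n * l j - pi * of_int (h n j) - \<theta> j) + s * l j - arctan (\<alpha> j / (T n + s))"
      by (simp add: y_def phase_def algebra_simps)
    then show ?thesis using 1 2 n(4)[OF j] by linarith
  qed
  have good: "cos (phase l \<alpha> (T n + s) j) \<noteq> 0" "\<bar>tan (phase l \<alpha> (T n + s) j) - \<tau> j\<bar> < \<epsilon>"
    if j: "j \<in> {1..N}" and s: "\<bar>s\<bar> \<le> r" for s j
    using \<rho>(2)[OF j close[OF j s]] cos_neq_zero_pi[of "y n s j"] cos_y[of n s j] tan_y[of n s j]
    by simp_all
  have cont: "continuous_on {T n - r..T n + r} g"
  proof -
    have "cos (phase l \<alpha> k j) \<noteq> 0" if "j \<in> {1..N}" "k \<in> {T n - r..T n + r}" for j k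
      using good(1)[of j "k - T n"] that by (auto simp: abs_le_iff)
    then show ?thesis
      unfolding g_def phase_def using n(3) r by (intro continuous_intros) auto
  qed
  obtain k where k: "T n - r \<le> k" "k \<le> T n + r" "g k = 0"
    using IVT'[of g "T n - r" 0 "T n + r"] n(1,2) r cont by auto
  have "\<bar>k - T n\<bar> \<le> r" using k by auto
  from good[OF _ this] have "\<forall>j\<in>{1..N}. cos (phase l \<alpha> k j) \<noteq> 0 \<and> \<bar>tan (phase l \<alpha> k j) - \<tau> j\<bar> < \<epsilon>"
    by simp
  then show ?thesis
    using k n(3) unfolding secular_solution_def g_def by (intro exI[of _ k]) auto
qed

lemma secular_sequence:
  assumes "rationally_independent {1..N} l" "\<And>j. j \<in> {1..N} \<Longrightarrow> l j > 0"
    "N \<ge> 1" "(\<Sum>j=1..N. \<tau> j) = 0"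
  obtains \<kappa> where "\<And>n. \<kappa> n > 0" "filterlim \<kappa> at_top sequentially"
    "\<And>n. secular_solution N l \<alpha> (\<kappa> n)"
    "\<And>n j. j \<in> {1..N} \<Longrightarrow> cos (phase l \<alpha> (\<kappa> n) j) \<noteq> 0"
    "\<And>j. j \<in> {1..N} \<Longrightarrow> (\<lambda>n. tan (phase l \<alpha> (\<kappa> n) j)) \<longlonglongrightarrow> \<tau> j"
proof -
  have "\<exists>k>real n. k > 0 \<and> secular_solution N l \<alpha> k \<and>
     (\<forall>j\<in>{1..N}. cos (phase l \<alpha> k j) \<noteq> 0 \<and> \<bar>tan (phase l \<alpha> k j) - \<tau> j\<bar> < 1 / Suc n)" for n :: nat
    by (rule secular_solution_near[OF assms]) auto
  then obtain \<kappa> where \<kappa>: "\<And>n. \<kappa> n > real n" "\<And>n. \<kappa> n > 0" "\<And>n. secular_solution N l \<alpha> (\<kappa> n)"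
    "\<And>n j. j \<in> {1..N} \<Longrightarrow> cos (phase l \<alpha> (\<kappa> n) j) \<noteq> 0"
    "\<And>n j. j \<in> {1..N} \<Longrightarrow> \<bar>tan (phase l \<alpha> (\<kappa> n) j) - \<tau> j\<bar> < 1 / Suc n"
    by metis
  show thesis
  proof (rule that[OF \<kappa>(2) _ \<kappa>(3,4)])
    show "filterlim \<kappa> at_top sequentially"
      by (intro filterlim_at_top_mono[OF filterlim_real_sequentially] always_eventually allI
          less_imp_le[OF \<kappa>(1)])
    fix j assume j: "j \<in> {1..N}"
    show "(\<lambda>n. tan (phase l \<alpha> (\<kappa> n) j)) \<longlonglongrightarrow> \<tau> j"
      by (rule LIMSEQ_of_less_inverse_Suc) (rule \<kappa>(5)[OF j])
  qed
qed

section \<open>Comparing two vectors of coupling constants\<close>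

text \<open>
The tangent of the amount by which the phase grows when \<open>\<alpha>\<close> is replaced by \<open>\<alpha>'\<close>.
\<close>

definition tan_shift_amount :: "(nat \<Rightarrow> real) \<Rightarrow> (nat \<Rightarrow> real) \<Rightarrow> real \<Rightarrow> nat \<Rightarrow> real" where
  "tan_shift_amount \<alpha> \<alpha>' k j = tan (arctan (\<alpha> j / k) - arctan (\<alpha>' j / k))"

lemma at_top_imp_inverse_tendsto_0:
  "filterlim \<kappa> at_top F \<Longrightarrow> ((\<lambda>n. c / \<kappa> n) \<longlongrightarrow> (0::real)) F"
  by (rule real_tendsto_divide_at_top[OF tendsto_const])

lemma sin_arctan_eq: "sin (arctan x) = x * cos (arctan x)"
  using tan_arctan[of x] cos_arctan_not_zero[of x] by (simp add: tan_def divide_eq_eq)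

lemma cos_diff_arctan:
  "cos (arctan x - arctan y) = (1 + x * y) * (cos (arctan x) * cos (arctan y))"
  by (simp add: cos_diff sin_arctan_eq algebra_simps)

lemma tan_shift_amount_eq:
  assumes "1 + \<alpha> j * \<alpha>' j / k\<^sup>2 > 0" "k > 0"
  shows "tan_shift_amount \<alpha> \<alpha>' k j = (\<alpha> j - \<alpha>' j) / k / (1 + \<alpha> j * \<alpha>' j / k\<^sup>2)"
proof -
  have "cos (arctan (\<alpha> j / k) - arctan (\<alpha>' j / k)) \<noteq> 0"
    using assms by (simp add: cos_diff_arctan cos_arctan_not_zero power2_eq_square)
  then show ?thesis
    unfolding tan_shift_amount_def
    by (subst tan_diff) (simp_all add: cos_arctan_not_zero tan_arctan power2_eq_square diff_divide_distrib)
qed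

text \<open>
This is the addition theorem \<open>tan (y + d) - tan y = tan d * (1 + (tan y)\<^sup>2) / (1 - tan d * tan y)\<close>.
In this form of the difference, \<open>tan d\<close> is a factor, and it is of order \<open>1 / k\<close>.
\<close>

lemma tan_phase_change:
  assumes c: "cos (phase l \<alpha> k j) \<noteq> 0" and k: "1 + \<alpha> j * \<alpha>' j / k\<^sup>2 > 0" "k > 0"
    and b: "1 - tan_shift_amount \<alpha> \<alpha>' k j * tan (phase l \<alpha> k j) \<noteq> 0"
  shows "cos (phase l \<alpha>' k j) \<noteq> 0"
    and "tan (phase l \<alpha>' k j) - tan (phase l \<alpha> k j) =
      tan_shift_amount \<alpha> \<alpha>' k j * (1 + (tan (phase l \<alpha> k j))\<^sup>2) / (1 - tan_shift_amount \<alpha> \<alpha>' k j * tan (phase l \<alpha> k j))"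
proof -
  define y where "y = phase l \<alpha> k j"
  define d where "d = arctan (\<alpha> j / k) - arctan (\<alpha>' j / k)"
  have y': "phase l \<alpha>' k j = y + d" by (simp add: phase_def y_def d_def)
  have d: "cos d \<noteq> 0"
    using k by (simp add: d_def cos_diff_arctan cos_arctan_not_zero power2_eq_square)
  have td: "tan d = tan_shift_amount \<alpha> \<alpha>' k j" by (simp add: tan_shift_amount_def d_def)
  have c': "cos y \<noteq> 0" using c by (simp add: y_def)
  have "cos (y + d) = cos y * cos d * (1 - tan d * tan y)"
    using c' d by (simp add: cos_add tan_def field_simps)
  then show cosne: "cos (phase l \<alpha>' k j) \<noteq> 0"
    using c' d b by (simp add: y' td y_def)
  have "tan (y + d) - tan y = (tan y + tan d) / (1 - tan y * tan d) - tan y"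
    using cosne c' d by (subst tan_add) (simp_all add: y')
  also have "\<dots> = tan d * (1 + (tan y)\<^sup>2) / (1 - tan d * tan y)"
    using b unfolding y_def[symmetric] td[symmetric]
    by (simp add: field_simps power2_eq_square)
  finally show "tan (phase l \<alpha>' k j) - tan (phase l \<alpha> k j) =
      tan_shift_amount \<alpha> \<alpha>' k j * (1 + (tan (phase l \<alpha> k j))\<^sup>2) / (1 - tan_shift_amount \<alpha> \<alpha>' k j * tan (phase l \<alpha> k j))"
    by (simp add: y' td y_def)
qed

text \<open>
Isospectrality enters the comparison only in this form.  The exclusion of zeros of the cosines
leaves out wave numbers at which an edge can carry a wave that vanishes at the centre.
\<close>

definition shares_secular_solutions ::
    "nat \<Rightarrow> (nat \<Rightarrow> real) \<Rightarrow> (nat \<Rightarrow> real) \<Rightarrow> (nat \<Rightarrow> real) \<Rightarrow> bool" where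
  "shares_secular_solutions N l \<alpha> \<alpha>' \<longleftrightarrow> (\<forall>k>0.
     (\<forall>j\<in>{1..N}. cos (phase l \<alpha> k j) \<noteq> 0 \<and> cos (phase l \<alpha>' k j) \<noteq> 0) \<longrightarrow>
     secular_solution N l \<alpha> k \<longrightarrow> secular_solution N l \<alpha>' k)"

text \<open>
Along roots for \<open>\<alpha>\<close> whose tangents \<open>u\<close> converge, the shift amounts \<open>b\<close> tend to 0, so the phases for
\<open>\<alpha>'\<close> are eventually off the poles of the tangent too, and these roots are roots for \<open>\<alpha>'\<close>.  The
difference of the two secular equations is the last conclusion.
\<close>

lemma shared_sequence:
  assumes ri: "rationally_independent {1..N} l" and l: "\<And>j. j \<in> {1..N} \<Longrightarrow> l j > 0"
    and N: "N \<ge> 1" and \<tau>: "(\<Sum>j=1..N. \<tau> j) = 0"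
    and sh: "shares_secular_solutions N l \<alpha> \<alpha>'"
  obtains \<kappa> u b where "filterlim \<kappa> at_top sequentially"
    "\<And>n. \<kappa> n > 0"
    "\<And>j. j \<in> {1..N} \<Longrightarrow> (\<lambda>n. u n j) \<longlonglongrightarrow> \<tau> j"
    "\<And>n. (\<Sum>j=1..N. u n j) = \<alpha> (N + 1) / \<kappa> n"
    "\<And>j. j \<in> {1..N} \<Longrightarrow> (\<lambda>n. \<kappa> n * b n j) \<longlonglongrightarrow> \<alpha> j - \<alpha>' j"
    "\<And>j. j \<in> {1..N} \<Longrightarrow> (\<lambda>n. b n j) \<longlonglongrightarrow> 0"
    "\<forall>\<^sub>F n in sequentially. \<forall>j\<in>{1..N}. 1 + \<alpha> j * \<alpha>' j / (\<kappa> n)\<^sup>2 > 0 \<and> 1 - b n j * u n j > 0 \<and>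
        b n j = (\<alpha> j - \<alpha>' j) / \<kappa> n / (1 + \<alpha> j * \<alpha>' j / (\<kappa> n)\<^sup>2)"
    "\<forall>\<^sub>F n in sequentially.
        (\<Sum>j=1..N. b n j * (1 + (u n j)\<^sup>2) / (1 - b n j * u n j)) = (\<alpha>' (N + 1) - \<alpha> (N + 1)) / \<kappa> n"
proof -
  obtain \<kappa> where \<kappa>: "\<And>n. \<kappa> n > 0" "filterlim \<kappa> at_top sequentially"
    "\<And>n. secular_solution N l \<alpha> (\<kappa> n)"
    "\<And>n j. j \<in> {1..N} \<Longrightarrow> cos (phase l \<alpha> (\<kappa> n) j) \<noteq> 0"
    "\<And>j. j \<in> {1..N} \<Longrightarrow> (\<lambda>n. tan (phase l \<alpha> (\<kappa> n) j)) \<longlonglongrightarrow> \<tau> j"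
    by (rule secular_sequence[OF ri l N \<tau>, where \<alpha> = \<alpha>], assumption, rule that)
  define u where "u n j = tan (phase l \<alpha> (\<kappa> n) j)" for n j
  define b where "b n j = tan_shift_amount \<alpha> \<alpha>' (\<kappa> n) j" for n j
  have sq: "(\<lambda>n. 1 + c / (\<kappa> n)\<^sup>2) \<longlonglongrightarrow> 1" for c
  proof -
    have "(\<lambda>n. 1 + c / \<kappa> n * (1 / \<kappa> n)) \<longlonglongrightarrow> 1 + 0 * 0"
      by (intro tendsto_intros at_top_imp_inverse_tendsto_0[OF \<kappa>(2)])
    then show ?thesis by (simp add: power2_eq_square)
  qed
  have ev1: "\<forall>\<^sub>F n in sequentially. 1 + \<alpha> j * \<alpha>' j / (\<kappa> n)\<^sup>2 > 0" for j
    by (rule order_tendstoD(1)[OF sq]) simp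
  have beq: "\<forall>\<^sub>F n in sequentially. b n j = (\<alpha> j - \<alpha>' j) / \<kappa> n / (1 + \<alpha> j * \<alpha>' j / (\<kappa> n)\<^sup>2)" for j
    using ev1[of j] by eventually_elim (simp add: b_def tan_shift_amount_eq \<kappa>(1))
  have kb: "(\<lambda>n. \<kappa> n * b n j) \<longlonglongrightarrow> \<alpha> j - \<alpha>' j" for j
  proof (rule Lim_transform_eventually)
    have "(\<lambda>n. (\<alpha> j - \<alpha>' j) / (1 + \<alpha> j * \<alpha>' j / (\<kappa> n)\<^sup>2)) \<longlonglongrightarrow> (\<alpha> j - \<alpha>' j) / 1"
      by (intro tendsto_divide tendsto_const sq) simp
    then show "(\<lambda>n. (\<alpha> j - \<alpha>' j) / (1 + \<alpha> j * \<alpha>' j / (\<kappa> n)\<^sup>2)) \<longlonglongrightarrow> \<alpha> j - \<alpha>' j" by simp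
    show "\<forall>\<^sub>F n in sequentially. (\<alpha> j - \<alpha>' j) / (1 + \<alpha> j * \<alpha>' j / (\<kappa> n)\<^sup>2) = \<kappa> n * b n j"
      using beq[of j]
    proof eventually_elim
      case (elim n)
      then show ?case using \<kappa>(1)[of n] by simp
    qed
  qed
  have b0: "(\<lambda>n. b n j) \<longlonglongrightarrow> 0" for j
  proof -
    have "(\<lambda>n. (\<kappa> n * b n j) * (1 / \<kappa> n)) \<longlonglongrightarrow> (\<alpha> j - \<alpha>' j) * 0"
      by (intro tendsto_mult kb at_top_imp_inverse_tendsto_0[OF \<kappa>(2)])
    moreover have "(\<kappa> n * b n j) * (1 / \<kappa> n) = b n j" for n using \<kappa>(1)[of n] by simp
    ultimately show ?thesis by simp
  qed
  have ev2: "\<forall>\<^sub>F n in sequentially. 1 - b n j * u n j > 0" if "j \<in> {1..N}" for j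
  proof -
    have "(\<lambda>n. 1 - b n j * u n j) \<longlonglongrightarrow> 1 - 0 * \<tau> j"
      using \<kappa>(5)[OF that] by (intro tendsto_intros b0) (simp add: u_def)
    from order_tendstoD(1)[OF this, of 0] show ?thesis by simp
  qed
  have all: "\<forall>\<^sub>F n in sequentially. \<forall>j\<in>{1..N}. 1 + \<alpha> j * \<alpha>' j / (\<kappa> n)\<^sup>2 > 0 \<and> 1 - b n j * u n j > 0 \<and>
        b n j = (\<alpha> j - \<alpha>' j) / \<kappa> n / (1 + \<alpha> j * \<alpha>' j / (\<kappa> n)\<^sup>2)"
    by (intro eventually_ball_finite ballI eventually_conj ev1 ev2 beq) auto
  have sec: "(\<Sum>j=1..N. u n j) = \<alpha> (N + 1) / \<kappa> n" for n
    using \<kappa>(3)[of n] by (simp add: secular_solution_def u_def)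
  have "\<forall>\<^sub>F n in sequentially.
        (\<Sum>j=1..N. b n j * (1 + (u n j)\<^sup>2) / (1 - b n j * u n j)) = (\<alpha>' (N + 1) - \<alpha> (N + 1)) / \<kappa> n"
    using all
  proof eventually_elim
    case (elim n)
    have *: "cos (phase l \<alpha>' (\<kappa> n) j) \<noteq> 0"
       "tan (phase l \<alpha>' (\<kappa> n) j) - u n j = b n j * (1 + (u n j)\<^sup>2) / (1 - b n j * u n j)"
      if j: "j \<in> {1..N}" for j
    proof -
      have "1 + \<alpha> j * \<alpha>' j / (\<kappa> n)\<^sup>2 > 0" "1 - b n j * u n j > 0" using elim j by blast+
      then have "1 + \<alpha> j * \<alpha>' j / (\<kappa> n)\<^sup>2 > 0" "1 - b n j * u n j \<noteq> 0" by simp_all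
      from tan_phase_change[OF \<kappa>(4)[OF j] this(1) \<kappa>(1) this(2)[unfolded b_def u_def]]
      show "cos (phase l \<alpha>' (\<kappa> n) j) \<noteq> 0"
        "tan (phase l \<alpha>' (\<kappa> n) j) - u n j = b n j * (1 + (u n j)\<^sup>2) / (1 - b n j * u n j)"
        unfolding b_def u_def .
    qed
    have "secular_solution N l \<alpha>' (\<kappa> n)"
      using sh[unfolded shares_secular_solutions_def, rule_format, OF \<kappa>(1)[of n] _ \<kappa>(3)[of n]]
        *(1) \<kappa>(4) by blast
    then have "(\<Sum>j=1..N. tan (phase l \<alpha>' (\<kappa> n) j) - u n j) = (\<alpha>' (N + 1) - \<alpha> (N + 1)) / \<kappa> n"
      using sec[of n] by (simp add: sum_subtractf secular_solution_def diff_divide_distrib)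
    moreover have "(\<Sum>j=1..N. tan (phase l \<alpha>' (\<kappa> n) j) - u n j)
        = (\<Sum>j=1..N. b n j * (1 + (u n j)\<^sup>2) / (1 - b n j * u n j))"
      by (intro sum.cong refl *(2))
    ultimately show ?case by simp
  qed
  then show thesis
    using \<kappa>(5) by (intro that[of \<kappa> u b] \<kappa>(1,2) sec kb b0 all) (simp_all add: u_def)
qed

text \<open>
Multiply the difference of the secular equations by \<open>\<kappa> n\<close> and let \<open>n\<close> tend to infinity.
\<close>

lemma shared_first_order:
  assumes ri: "rationally_independent {1..N} l" and l: "\<And>j. j \<in> {1..N} \<Longrightarrow> l j > 0"
    and N: "N \<ge> 1" and \<tau>: "(\<Sum>j=1..N. \<tau> j) = 0"
    and sh: "shares_secular_solutions N l \<alpha> \<alpha>'"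
  shows "(\<Sum>j=1..N. (\<alpha> j - \<alpha>' j) * (1 + (\<tau> j)\<^sup>2)) = \<alpha>' (N + 1) - \<alpha> (N + 1)"
proof -
  obtain \<kappa> u b where \<kappa>: "filterlim \<kappa> at_top sequentially" "\<And>n. \<kappa> n > 0"
    and u: "\<And>j. j \<in> {1..N} \<Longrightarrow> (\<lambda>n. u n j) \<longlonglongrightarrow> \<tau> j"
    and kb: "\<And>j. j \<in> {1..N} \<Longrightarrow> (\<lambda>n. \<kappa> n * b n j) \<longlonglongrightarrow> \<alpha> j - \<alpha>' j"
    and b: "\<And>j. j \<in> {1..N} \<Longrightarrow> (\<lambda>n. b n j) \<longlonglongrightarrow> 0"
    and eq: "\<forall>\<^sub>F n in sequentially.
        (\<Sum>j=1..N. b n j * (1 + (u n j)\<^sup>2) / (1 - b n j * u n j)) = (\<alpha>' (N + 1) - \<alpha> (N + 1)) / \<kappa> n"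
    by (rule shared_sequence[OF assms], assumption, rule that)
  have "(\<lambda>n. \<Sum>j=1..N. (\<kappa> n * b n j) * (1 + (u n j)\<^sup>2) / (1 - b n j * u n j))
     \<longlonglongrightarrow> (\<Sum>j=1..N. (\<alpha> j - \<alpha>' j) * (1 + (\<tau> j)\<^sup>2) / (1 - 0 * \<tau> j))"
    by (intro tendsto_intros u kb b) auto
  moreover have "\<forall>\<^sub>F n in sequentially. (\<Sum>j=1..N. (\<kappa> n * b n j) * (1 + (u n j)\<^sup>2) / (1 - b n j * u n j))
      = \<alpha>' (N + 1) - \<alpha> (N + 1)"
    using eq
  proof eventually_elim
    case (elim n)
    have "(\<Sum>j=1..N. (\<kappa> n * b n j) * (1 + (u n j)\<^sup>2) / (1 - b n j * u n j))
        = \<kappa> n * (\<Sum>j=1..N. b n j * (1 + (u n j)\<^sup>2) / (1 - b n j * u n j))"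
      by (simp add: sum_distrib_left mult.assoc)
    then show ?case using elim \<kappa>(2)[of n] by simp
  qed
  ultimately have "(\<lambda>n. \<alpha>' (N + 1) - \<alpha> (N + 1))
     \<longlonglongrightarrow> (\<Sum>j=1..N. (\<alpha> j - \<alpha>' j) * (1 + (\<tau> j)\<^sup>2) / (1 - 0 * \<tau> j))"
    by (rule Lim_transform_eventually)
  then show ?thesis by (simp add: LIMSEQ_const_iff)
qed

text \<open>
For two edges the first order leaves open that the boundary constants change by opposite amounts
$\beta$ and $-\beta$.  If $\beta \neq 0$, it cancels from the difference of the secular equations,
and the next order at \<open>\<tau> = (1, -1)\<close> can be read off.  Up to factors that tend to 1, what remains
is $1 + u_1^2 = 1 + u_2^2$; since $\kappa (u_1 + u_2)$ equals the constant \<open>\<alpha> 3\<close> at the centre, the limit of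
$\kappa (u_1^2 - u_2^2)$ is \<open>2 * \<alpha> 3\<close>.  The contributions of the factors cancel, hence
\<open>\<alpha> 3 = 0\<close>.
\<close>

lemma shared_second_order:
  assumes ri: "rationally_independent {1..2} l" and l: "\<And>j. j \<in> {1..2} \<Longrightarrow> l j > 0"
    and sh: "shares_secular_solutions 2 l \<alpha> \<alpha>'"
    and opp: "\<alpha> 1 - \<alpha>' 1 = - (\<alpha> 2 - \<alpha>' 2)" and hub: "\<alpha> 3 = \<alpha>' 3" "\<alpha> 3 \<noteq> 0"
  shows "\<alpha> 1 = \<alpha>' 1"
proof (rule ccontr)
  assume ne: "\<alpha> 1 \<noteq> \<alpha>' 1"
  define \<beta> where "\<beta> = \<alpha> 1 - \<alpha>' 1"
  have \<beta>: "\<beta> \<noteq> 0" using ne by (simp add: \<beta>_def)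
  have two: "{Suc 0..2} = {1, 2}" by auto
  define \<tau> :: "nat \<Rightarrow> real" where "\<tau> j = (if j = 1 then 1 else - 1)" for j
  have \<tau>0: "(\<Sum>j=1..2. \<tau> j) = 0" by (simp add: \<tau>_def two)
  obtain \<kappa> u b where \<kappa>: "filterlim \<kappa> at_top sequentially" "\<And>n. \<kappa> n > 0"
    and u: "\<And>j. j \<in> {1..2} \<Longrightarrow> (\<lambda>n. u n j) \<longlonglongrightarrow> \<tau> j"
    and us: "\<And>n. (\<Sum>j=1..2. u n j) = \<alpha> (2 + 1) / \<kappa> n"
    and kb: "\<And>j. j \<in> {1..2} \<Longrightarrow> (\<lambda>n. \<kappa> n * b n j) \<longlonglongrightarrow> \<alpha> j - \<alpha>' j"
    and b: "\<And>j. j \<in> {1..2} \<Longrightarrow> (\<lambda>n. b n j) \<longlonglongrightarrow> 0"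
    and ev: "\<forall>\<^sub>F n in sequentially. \<forall>j\<in>{1..2}. 1 + \<alpha> j * \<alpha>' j / (\<kappa> n)\<^sup>2 > 0 \<and> 1 - b n j * u n j > 0 \<and>
        b n j = (\<alpha> j - \<alpha>' j) / \<kappa> n / (1 + \<alpha> j * \<alpha>' j / (\<kappa> n)\<^sup>2)"
    and eq: "\<forall>\<^sub>F n in sequentially.
        (\<Sum>j=1..2. b n j * (1 + (u n j)\<^sup>2) / (1 - b n j * u n j)) = (\<alpha>' (2 + 1) - \<alpha> (2 + 1)) / \<kappa> n"
    by (rule shared_sequence[OF ri l _ \<tau>0 sh], assumption, simp, rule that)
  \<comment> \<open>The factor \<open>(1 + c n j) * (1 - b n j * u n j)\<close> is \<open>1 + W n j / \<kappa> n\<close>, so \<open>W\<close> is its first-order part.\<close>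
  define c where "c n j = \<alpha> j * \<alpha>' j / (\<kappa> n)\<^sup>2" for n j
  define W where "W n j = \<kappa> n * c n j * (1 - b n j * u n j) - \<kappa> n * b n j * u n j" for n j
  have kc: "(\<lambda>n. \<kappa> n * c n j) \<longlonglongrightarrow> 0" for j
  proof -
    have "\<kappa> n * c n j = \<alpha> j * \<alpha>' j / \<kappa> n" for n
      using \<kappa>(2)[of n] by (simp add: c_def power2_eq_square)
    then show ?thesis using at_top_imp_inverse_tendsto_0[OF \<kappa>(1)] by simp
  qed
  have W: "(\<lambda>n. W n j) \<longlonglongrightarrow> - ((\<alpha> j - \<alpha>' j) * \<tau> j)" if j: "j \<in> {1..2}" for j
  proof -
    have "(\<lambda>n. W n j) \<longlonglongrightarrow> 0 * (1 - 0 * \<tau> j) - (\<alpha> j - \<alpha>' j) * \<tau> j"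
      unfolding W_def by (intro tendsto_intros kc kb[OF j] b[OF j] u[OF j])
    then show ?thesis by simp
  qed
  have "(\<lambda>n. \<alpha> 3 * (u n 1 - u n 2) + (1 + (u n 1)\<^sup>2) * W n 2 - (1 + (u n 2)\<^sup>2) * W n 1)
    \<longlonglongrightarrow> \<alpha> 3 * (\<tau> 1 - \<tau> 2) + (1 + (\<tau> 1)\<^sup>2) * (- ((\<alpha> 2 - \<alpha>' 2) * \<tau> 2)) - (1 + (\<tau> 2)\<^sup>2) * (- ((\<alpha> 1 - \<alpha>' 1) * \<tau> 1))"
    by (intro tendsto_intros W u) (auto simp: two)
  moreover have "\<forall>\<^sub>F n in sequentially.
     \<alpha> 3 * (u n 1 - u n 2) + (1 + (u n 1)\<^sup>2) * W n 2 - (1 + (u n 2)\<^sup>2) * W n 1 = 0"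
    using ev eq
  proof eventually_elim
    case (elim n)
    define p1 p2 where "p1 = 1 - b n 1 * u n 1" and "p2 = 1 - b n 2 * u n 2"
    have 12: "1 \<in> {1..2::nat}" "2 \<in> {1..2::nat}" by auto
    have p: "p1 > 0" "p2 > 0" and c: "1 + c n 1 > 0" "1 + c n 2 > 0"
      using elim(1) 12 unfolding p1_def p2_def c_def by blast+
    have "\<alpha> 2 - \<alpha>' 2 = - \<beta>" using opp by (simp add: \<beta>_def)
    then have bb: "b n 1 = \<beta> / \<kappa> n / (1 + c n 1)" "b n 2 = - \<beta> / \<kappa> n / (1 + c n 2)"
      using elim(1)[rule_format, OF 12(1)] elim(1)[rule_format, OF 12(2)]
      by (simp_all only: c_def \<beta>_def)
    have "b n 1 * (1 + (u n 1)\<^sup>2) / p1 + b n 2 * (1 + (u n 2)\<^sup>2) / p2 = 0"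
      using elim(2) hub by (simp add: two p1_def p2_def)
    then have "\<beta> / \<kappa> n * ((1 + (u n 1)\<^sup>2) / ((1 + c n 1) * p1) - (1 + (u n 2)\<^sup>2) / ((1 + c n 2) * p2)) = 0"
      unfolding bb by (simp add: right_diff_distrib mult.assoc)
    then have "(1 + (u n 1)\<^sup>2) / ((1 + c n 1) * p1) = (1 + (u n 2)\<^sup>2) / ((1 + c n 2) * p2)"
      using \<beta> \<kappa>(2)[of n] by simp
    then have cross: "(1 + (u n 1)\<^sup>2) * ((1 + c n 2) * p2) = (1 + (u n 2)\<^sup>2) * ((1 + c n 1) * p1)"
      using p c by (simp add: frac_eq_eq)
    have sum: "\<kappa> n * (u n 1 + u n 2) = \<alpha> 3"
      using us[of n] \<kappa>(2)[of n] by (simp add: two)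
    have "\<kappa> n * ((1 + c n j) * (1 - b n j * u n j)) = \<kappa> n + W n j" for j
      by (simp add: W_def algebra_simps)
    then have "(1 + (u n 1)\<^sup>2) * (\<kappa> n + W n 2) = (1 + (u n 2)\<^sup>2) * (\<kappa> n + W n 1)"
      using cross unfolding p1_def p2_def by (metis mult.left_commute)
    then have "\<kappa> n * (u n 1 + u n 2) * (u n 1 - u n 2) + (1 + (u n 1)\<^sup>2) * W n 2 - (1 + (u n 2)\<^sup>2) * W n 1 = 0"
      by (simp add: algebra_simps power2_eq_square)
    then show ?case by (simp only: sum)
  qed
  ultimately have "(\<lambda>n. 0) \<longlonglongrightarrow> \<alpha> 3 * (\<tau> 1 - \<tau> 2) + (1 + (\<tau> 1)\<^sup>2) * (- ((\<alpha> 2 - \<alpha>' 2) * \<tau> 2)) - (1 + (\<tau> 2)\<^sup>2) * (- ((\<alpha> 1 - \<alpha>' 1) * \<tau> 1))"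
    by (rule Lim_transform_eventually)
  then have "\<alpha> 3 * (\<tau> 1 - \<tau> 2) + (1 + (\<tau> 1)\<^sup>2) * (- ((\<alpha> 2 - \<alpha>' 2) * \<tau> 2)) - (1 + (\<tau> 2)\<^sup>2) * (- ((\<alpha> 1 - \<alpha>' 1) * \<tau> 1)) = 0"
    by (simp add: LIMSEQ_const_iff)
  then show False using opp hub(2) by (simp add: \<tau>_def)
qed

text \<open>
The first-order relation holds for all \<open>\<tau>\<close> of sum 0.  Its value at \<open>\<tau> = 0\<close> turns it into
\<open>(\<Sum>j=1..N. \<beta> j * (\<tau> j)\<^sup>2) = 0\<close>, and taking \<open>\<tau>\<close> to be 1 at \<open>i\<close> and -1 at \<open>j\<close> gives \<open>\<beta> i + \<beta> j = 0\<close>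
for any two edges.  With three edges at hand this forces all \<open>\<beta> i\<close> to vanish.
\<close>

theorem couplings_determined_by_secular_solutions:
  assumes N: "N \<ge> 2" and ri: "rationally_independent {1..N} l"
    and l: "\<And>j. j \<in> {1..N} \<Longrightarrow> l j > 0"
    and hub: "N = 2 \<Longrightarrow> \<alpha> (N + 1) \<noteq> 0"
    and sh: "shares_secular_solutions N l \<alpha> \<alpha>'"
  shows "\<forall>k\<in>{1..N + 1}. \<alpha> k = \<alpha>' k"
proof -
  define \<beta> where "\<beta> j = \<alpha> j - \<alpha>' j" for j
  have first: "(\<Sum>j=1..N. \<beta> j * (1 + (\<tau> j)\<^sup>2)) = - \<beta> (N + 1)" if "(\<Sum>j=1..N. \<tau> j) = 0" for \<tau>
    using shared_first_order[OF ri l _ that sh] N by (simp add: \<beta>_def)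
  have zero: "(\<Sum>j=1..N. \<beta> j) = - \<beta> (N + 1)" using first[of "\<lambda>_. 0"] by simp
  have pair: "\<beta> i + \<beta> j = 0" if ij: "i \<in> {1..N}" "j \<in> {1..N}" "i \<noteq> j" for i j
  proof -
    define \<tau> :: "nat \<Rightarrow> real" where "\<tau> x = (if x = i then 1 else 0) - (if x = j then 1 else 0)" for x
    have "(\<Sum>j=1..N. \<tau> j) = 0" using ij by (simp add: \<tau>_def sum_subtractf)
    from first[OF this] zero have "(\<Sum>x=1..N. \<beta> x * (\<tau> x)\<^sup>2) = 0"
      by (simp add: distrib_left sum.distrib)
    moreover have "(\<Sum>x=1..N. \<beta> x * (\<tau> x)\<^sup>2) = (\<Sum>x=1..N. (if x = i then \<beta> i else 0) + (if x = j then \<beta> j else 0))"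
      using ij(3) by (intro sum.cong) (auto simp: \<tau>_def)
    ultimately show ?thesis using ij by (simp add: sum.distrib)
  qed
  have leaves: "\<beta> i = 0" if i: "i \<in> {1..N}" for i
  proof (cases "N = 2")
    case True
    have two: "{Suc 0..2} = {1, 2}" by auto
    have "\<beta> 1 + \<beta> 2 = 0" using pair[of 1 2] True by simp
    moreover from this have "\<beta> 3 = 0" using zero by (simp add: two True)
    ultimately have "\<alpha> 1 = \<alpha>' 1"
      using True ri l hub sh by (intro shared_second_order[of l \<alpha> \<alpha>']) (auto simp: \<beta>_def)
    then show ?thesis using i True \<open>\<beta> 1 + \<beta> 2 = 0\<close> by (auto simp: two \<beta>_def)
  next
    case False
    define j where "j = (if i = 1 then 2 else 1::nat)"
    define m where "m = (if i = 3 then 2 else if i = 2 then 3 else 3::nat)"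
    have "j \<in> {1..N}" "m \<in> {1..N}" "i \<noteq> j" "i \<noteq> m" "j \<noteq> m"
      using i N False by (auto simp: j_def m_def)
    then show ?thesis using pair[OF i, of j] pair[OF i, of m] pair[of j m] by simp
  qed
  moreover have "\<beta> (N + 1) = 0" using zero leaves by simp
  ultimately show ?thesis by (auto simp: \<beta>_def le_Suc_eq)
qed

section \<open>Standing waves on a star\<close>

text \<open>
The usual argument that \<open>f\<close>, rotated back by the angle \<open>k * (x - p)\<close> in the phase plane with
coordinates \<open>k * f\<close> and \<open>f'\<close>, is constant.  The equation $f'' = -k^2 f$ is only given in its
integrated form, but as \<open>f\<close> is continuous, this shows that \<open>f'\<close> is differentiable.
\<close>

lemma harmonic_oscillator_unique:
  fixes f :: "real \<Rightarrow> complex"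
  assumes ab: "a < b" and k: "k \<noteq> 0" and f: "f differentiable_on {a..b}"
    and D: "\<And>x. D x = vector_derivative f (at x within {a..b})"
    and int: "\<And>x. x \<in> {a..b} \<Longrightarrow>
      ((\<lambda>t. - (of_real (k\<^sup>2) * f t)) has_integral (D x - D a)) {a..x}"
    and p: "p \<in> {a..b}" and x: "x \<in> {a..b}"
  shows "f x = f p * of_real (cos (k * (x - p))) + D p * of_real (sin (k * (x - p)) / k)"
proof -
  have f': "(f has_vector_derivative D y) (at y within {a..b})" if "y \<in> {a..b}" for y
    using f that unfolding D differentiable_on_def vector_derivative_works by blast
  have cont: "continuous_on {a..b} (\<lambda>t. - (of_real (k\<^sup>2) * f t))"
    using differentiable_imp_continuous_on[OF f] by (intro continuous_intros)
  have D': "(D has_vector_derivative - (of_real (k\<^sup>2) * f y)) (at y within {a..b})" if y: "y \<in> {a..b}" for y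
  proof (rule has_vector_derivative_transform[OF y])
    show "D t = D a + integral {a..t} (\<lambda>t. - (of_real (k\<^sup>2) * f t))" if "t \<in> {a..b}" for t
      using integral_unique[OF int[OF that]] by simp
    show "((\<lambda>t. D a + integral {a..t} (\<lambda>t. - (of_real (k\<^sup>2) * f t))) has_vector_derivative
        - (of_real (k\<^sup>2) * f y)) (at y within {a..b})"
      using has_vector_derivative_add[OF has_vector_derivative_const
          integral_has_vector_derivative[OF cont y], of "D a"] by simp
  qed
  define S C where "S y = complex_of_real (sin (k * (y - p)))"
    and "C y = complex_of_real (cos (k * (y - p)))" for y
  have S': "(S has_vector_derivative of_real k * C y) (at y within {a..b})" for y
    unfolding S_def C_def
    by (rule has_vector_derivative_eq_rhs, rule has_vector_derivative_of_real)
       (auto intro!: derivative_eq_intros simp: has_real_derivative_iff_has_vector_derivative[symmetric])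
  have C': "(C has_vector_derivative - (of_real k * S y)) (at y within {a..b})" for y
    unfolding S_def C_def
    by (rule has_vector_derivative_eq_rhs, rule has_vector_derivative_of_real)
       (auto intro!: derivative_eq_intros simp: has_real_derivative_iff_has_vector_derivative[symmetric])
  have const: "\<exists>c. \<forall>y\<in>{a..b}. h y = c"
    if "\<And>y. y \<in> {a..b} \<Longrightarrow> (h has_vector_derivative 0) (at y within {a..b})" for h :: "real \<Rightarrow> complex"
    using that by (intro has_derivative_zero_constant) (auto simp: has_vector_derivative_def)
  define U V where "U y = of_real k * (f y * C y) - D y * S y"
    and "V y = of_real k * (f y * S y) + D y * C y" for y
  have "\<exists>c. \<forall>y\<in>{a..b}. U y = c"
  proof (rule const)
    fix y assume y: "y \<in> {a..b}"
    show "(U has_vector_derivative 0) (at y within {a..b})" unfolding U_def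
      by (rule has_vector_derivative_eq_rhs,
          rule has_vector_derivative_diff[OF has_vector_derivative_mult[OF has_vector_derivative_const
              has_vector_derivative_mult[OF f'[OF y] C']] has_vector_derivative_mult[OF D'[OF y] S']])
        (simp add: algebra_simps power2_eq_square)
  qed
  moreover have "\<exists>c. \<forall>y\<in>{a..b}. V y = c"
  proof (rule const)
    fix y assume y: "y \<in> {a..b}"
    show "(V has_vector_derivative 0) (at y within {a..b})" unfolding V_def
      by (rule has_vector_derivative_eq_rhs,
          rule has_vector_derivative_add[OF has_vector_derivative_mult[OF has_vector_derivative_const
              has_vector_derivative_mult[OF f'[OF y] S']] has_vector_derivative_mult[OF D'[OF y] C']])
        (simp add: algebra_simps power2_eq_square)
  qed
  ultimately have "U x = U p" "V x = V p" using p x by metis+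
  then have UV: "U x = of_real k * f p" "V x = D p" by (simp_all add: U_def V_def S_def C_def)
  have "C x * C x + S x * S x = 1"
    unfolding S_def C_def of_real_mult[symmetric] of_real_add[symmetric]
    using sin_cos_squared_add3[of "k * (x - p)"] by simp
  moreover have "U x * C x + V x * S x = of_real k * f x * (C x * C x + S x * S x)"
    by (simp add: U_def V_def algebra_simps)
  ultimately have "of_real k * f x = of_real k * f p * C x + D p * S x"
    using UV by simp
  then have "f x = f p * C x + D p * (S x / of_real k)"
    using k by (simp add: field_simps)
  then show ?thesis by (simp add: S_def C_def)
qed

text \<open>
Every edge is followed from the boundary to the centre: edge \<open>i\<close> goes from the endpoint \<open>leaf i\<close> at the
boundary vertex \<open>i\<close> to the endpoint \<open>hub i\<close> at the centre.  Each of the two may be the left one.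
\<close>

locale delta_star =
  fixes G :: metric_graph and N :: nat and l :: "nat \<Rightarrow> real" and leaf hub :: "nat \<Rightarrow> nat"
  assumes num_edges: "num_edges G = N" and num_verts: "num_verts G = N + 1"
    and ends: "i \<in> {1..N} \<Longrightarrow> leaf i = 2 * i - 1 \<and> hub i = 2 * i \<or> leaf i = 2 * i \<and> hub i = 2 * i - 1"
    and vertex_leaf: "i \<in> {1..N} \<Longrightarrow> vertex G i = {leaf i}"
    and vertex_hub: "vertex G (N + 1) = hub ` {1..N}"
    and length_pos: "i \<in> {1..N} \<Longrightarrow> l i > 0"
    and endpoint_diff: "i \<in> {1..N} \<Longrightarrow> endpoint G (2 * i) = endpoint G (2 * i - 1) + l i"
begin

text \<open>
The sign of the coordinate on edge \<open>i\<close> in the direction from the boundary to the centre.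
\<close>

definition dir :: "nat \<Rightarrow> real" where
  "dir i = (if odd (leaf i) then 1 else - 1)"

text \<open>
The standing wave that satisfies the condition at the boundary vertex, and its derivative with
respect to the coordinate of the edge.
\<close>

definition mode :: "(nat \<Rightarrow> real) \<Rightarrow> real \<Rightarrow> nat \<Rightarrow> real \<Rightarrow> real" where
  "mode \<alpha> k i x = cos (k * (dir i * (x - endpoint G (leaf i))) - arctan (\<alpha> i / k))"

definition mode' :: "(nat \<Rightarrow> real) \<Rightarrow> real \<Rightarrow> nat \<Rightarrow> real \<Rightarrow> real" where
  "mode' \<alpha> k i x = - (k * dir i * sin (k * (dir i * (x - endpoint G (leaf i))) - arctan (\<alpha> i / k)))"

text \<open>
The standing waves on the edges are scaled to have the value 1 at the centre.
\<close>

definition star_mode :: "(nat \<Rightarrow> real) \<Rightarrow> real \<Rightarrow> graph_fun" where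
  "star_mode \<alpha> k = (\<lambda>i x. if i \<in> {1..N} \<and> x \<in> edge G i
     then of_real (mode \<alpha> k i x / cos (phase l \<alpha> k i)) else 0)"

lemma dir_cases: "dir i = 1 \<or> dir i = - 1"
  by (simp add: dir_def)

lemma dir_sq: "dir i * dir i = 1"
  by (simp add: dir_def)

context
  fixes i assumes i: "i \<in> {1..N}"
begin

lemma edge_of_leaf: "(leaf i + 1) div 2 = i" and edge_of_hub: "(hub i + 1) div 2 = i"
  using ends[OF i] i by auto

lemma dir_leaf: "(if odd (leaf i) then 1 else - 1) = complex_of_real (dir i)"
  by (simp add: dir_def)

lemma dir_hub: "(if odd (hub i) then 1 else - 1) = - complex_of_real (dir i)"
proof -
  have "odd (2 * i - 1)" using i by simp
  then show ?thesis using ends[OF i] by (auto simp: dir_def)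
qed

lemma endpoint_hub: "endpoint G (hub i) = endpoint G (leaf i) + dir i * l i"
proof -
  have "odd (2 * i - 1)" using i by simp
  then show ?thesis using ends[OF i] endpoint_diff[OF i] by (auto simp: dir_def)
qed

lemma edge_interval: "endpoint G (2 * i - 1) < endpoint G (2 * i)"
  using endpoint_diff[OF i] length_pos[OF i] by simp

lemma ends_in_edge: "endpoint G (leaf i) \<in> edge G i" "endpoint G (hub i) \<in> edge G i"
  using ends[OF i] edge_interval by (auto simp: edge_def)

lemma edge_deriv_eq:
  assumes "\<And>x. x \<in> edge G i \<Longrightarrow> f i x = g x" "y \<in> edge G i"
    "(g has_vector_derivative g') (at y within edge G i)"
  shows "edge_deriv G f i y = g'"
  unfolding edge_deriv_def edge_def
proof (rule vector_derivative_within_closed_interval)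
  show "(f i has_vector_derivative g') (at y within {endpoint G (2 * i - 1)..endpoint G (2 * i)})"
    using has_vector_derivative_transform[of y "edge G i" "f i" g g'] assms by (simp add: edge_def)
qed (use edge_interval assms(2) in \<open>auto simp: edge_def\<close>)

lemma mode_deriv: "((\<lambda>x. c * complex_of_real (mode \<alpha> k i x)) has_vector_derivative
    c * of_real (mode' \<alpha> k i y)) (at y within S)"
proof -
  have "(mode \<alpha> k i has_real_derivative mode' \<alpha> k i y) (at y within S)"
    unfolding mode_def mode'_def by (auto intro!: derivative_eq_intros)
  then show ?thesis
    by (intro has_vector_derivative_mult_right has_vector_derivative_of_real)
       (simp add: has_real_derivative_iff_has_vector_derivative)
qed

lemma mode'_deriv: "((\<lambda>x. c * complex_of_real (mode' \<alpha> k i x)) has_vector_derivative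
    c * of_real (- (k\<^sup>2 * mode \<alpha> k i y))) (at y within S)"
proof -
  have "(mode' \<alpha> k i has_real_derivative - (k * k * (dir i * dir i) * mode \<alpha> k i y)) (at y within S)"
    unfolding mode_def mode'_def by (auto intro!: derivative_eq_intros simp: algebra_simps)
  then show ?thesis
    by (intro has_vector_derivative_mult_right has_vector_derivative_of_real)
       (simp add: has_real_derivative_iff_has_vector_derivative dir_sq power2_eq_square)
qed

lemma mode_leaf: "mode \<alpha> k i (endpoint G (leaf i)) = cos (arctan (\<alpha> i / k))"
  by (simp add: mode_def)

lemma mode'_leaf: "k \<noteq> 0 \<Longrightarrow> dir i * mode' \<alpha> k i (endpoint G (leaf i)) = \<alpha> i * cos (arctan (\<alpha> i / k))"
  using tan_arctan[of "\<alpha> i / k"] cos_arctan_not_zero[of "\<alpha> i / k"] dir_cases[of i]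
  by (auto simp: mode'_def tan_def field_simps)

lemma mode_hub: "mode \<alpha> k i (endpoint G (hub i)) = cos (phase l \<alpha> k i)"
  using dir_cases[of i] by (auto simp: mode_def phase_def endpoint_hub)

lemma mode'_hub: "dir i * mode' \<alpha> k i (endpoint G (hub i)) = - (k * sin (phase l \<alpha> k i))"
  using dir_cases[of i] by (auto simp: mode'_def phase_def endpoint_hub)

end

lemma inj_hub: "inj_on hub {1..N}"
  by (rule inj_onI) (metis edge_of_hub)

text \<open>
The value at the boundary vertex determines the whole function on the edge, because the \<open>\<delta>\<close>
condition there determines the derivative as well.  The quotient compensates for the value
\<open>cos (arctan (\<alpha> i / k))\<close> of \<open>mode\<close> at the boundary.
\<close>

lemma eigenfunction_on_edge:
  assumes f: "f \<in> eigenspace (laplacian G \<alpha>) (of_real (k\<^sup>2))" and k: "k > 0"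
    and i: "i \<in> {1..N}" and x: "x \<in> edge G i"
  shows "f i x = f i (endpoint G (leaf i)) / of_real (cos (arctan (\<alpha> i / k))) * of_real (mode \<alpha> k i x)"
proof -
  define p where "p = endpoint G (leaf i)"
  define D where "D = edge_deriv G f i"
  have dom: "f \<in> laplacian_domain G \<alpha>"
    and sd: "has_second_deriv G f (\<lambda>j x. - (of_real (k\<^sup>2) * f j x))"
    using f by (auto simp: eigenspace_def laplacian_def graph_fun_scale_def)
  have "i \<in> {1..num_edges G}" using i num_edges by simp
  with sd have diff: "f i differentiable_on edge G i"
    and int: "\<And>x. x \<in> edge G i \<Longrightarrow> ((\<lambda>x. - (of_real (k\<^sup>2) * f i x)) has_integral
       (D x - D (endpoint G (2 * i - 1)))) {endpoint G (2 * i - 1)..x}"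
    unfolding has_second_deriv_def D_def by blast+
  have sol: "f i x = f i p * of_real (cos (k * (x - p))) + D p * of_real (sin (k * (x - p)) / k)"
    using diff int x ends_in_edge(1)[OF i] k edge_interval[OF i] unfolding edge_def p_def
    by (intro harmonic_oscillator_unique[where a = "endpoint G (2 * i - 1)" and b = "endpoint G (2 * i)"])
       (auto simp: D_def edge_deriv_def edge_def)
  have "i \<in> {1..num_verts G}" "leaf i \<in> vertex G i" using i num_verts vertex_leaf[OF i] by auto
  with dom have "(\<Sum>i'\<in>vertex G i. normal_deriv G f i') = of_real (\<alpha> i) * endpoint_value G f (leaf i)"
    unfolding laplacian_domain_def by blast
  then have "of_real (dir i) * D p = of_real (\<alpha> i) * f i p"
    by (simp only: vertex_leaf[OF i] normal_deriv_def endpoint_value_def edge_of_leaf[OF i]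
        dir_leaf[OF i] p_def D_def sum.insert sum.empty finite.emptyI empty_iff if_False simp_thms add_0_right)
  then have "of_real (dir i * dir i) * D p = of_real (dir i * \<alpha> i) * f i p"
    by (simp add: mult.assoc)
  then have Dp: "D p = of_real (dir i * \<alpha> i) * f i p" by (simp add: dir_sq)
  define c where "c = cos (arctan (\<alpha> i / k))"
  have c: "c \<noteq> 0" by (simp add: c_def cos_arctan_not_zero)
  have sn: "sin (arctan (\<alpha> i / k)) = \<alpha> i / k * c"
    by (simp add: c_def sin_arctan_eq)
  have "mode \<alpha> k i x = c * (cos (k * (x - p)) + dir i * \<alpha> i * (sin (k * (x - p)) / k))"
  proof -
    define s where "s = k * (x - p)"
    have "k * (dir i * (x - endpoint G (leaf i))) = dir i * s" by (simp add: s_def p_def)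
    then have "mode \<alpha> k i x = cos (dir i * s) * c + sin (dir i * s) * (\<alpha> i / k * c)"
      by (simp only: mode_def cos_diff sn) (simp only: c_def)
    also have "\<dots> = c * (cos s + dir i * \<alpha> i * (sin s / k))"
      using dir_cases[of i] by (auto simp: algebra_simps)
    finally show ?thesis by (simp only: s_def)
  qed
  then have "cos (k * (x - p)) + dir i * \<alpha> i * (sin (k * (x - p)) / k) = mode \<alpha> k i x / c"
    using c by simp
  moreover have "f i x = f i p * of_real (cos (k * (x - p)) + dir i * \<alpha> i * (sin (k * (x - p)) / k))"
    unfolding sol Dp by (simp add: algebra_simps)
  ultimately show ?thesis by (simp add: p_def c_def)
qed

text \<open>
On each edge an eigenfunction is a multiple of the standing wave there.  Since none of these
vanishes at the centre, continuity makes all multiples agree up to the common value \<open>v\<close> at the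
centre, and the condition on the derivatives at the centre is \<open>v\<close> times the secular equation.
\<close>

lemma eigenfunction_eq_scaled_star_mode:
  assumes f: "f \<in> eigenspace (laplacian G \<alpha>) (of_real (k\<^sup>2))" and k: "k > 0" and N: "N \<ge> 1"
    and c: "\<And>i. i \<in> {1..N} \<Longrightarrow> cos (phase l \<alpha> k i) \<noteq> 0"
  shows "\<exists>v. f = graph_fun_scale v (star_mode \<alpha> k) \<and> (secular_solution N l \<alpha> k \<or> v = 0)"
proof -
  define A where "A i = f i (endpoint G (leaf i)) / of_real (cos (arctan (\<alpha> i / k)))" for i
  have fA: "f i x = A i * of_real (mode \<alpha> k i x)" if "i \<in> {1..N}" "x \<in> edge G i" for i x
    using eigenfunction_on_edge[OF f k that] by (simp add: A_def)
  have dom: "f \<in> laplacian_domain G \<alpha>"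
    using f by (auto simp: eigenspace_def laplacian_def)
  define v where "v = f 1 (endpoint G (hub 1))"
  have hubs: "hub i \<in> vertex G (N + 1)" if "i \<in> {1..N}" for i using that vertex_hub by blast
  have Nv: "N + 1 \<in> {1..num_verts G}" using num_verts by simp
  have one: "1 \<in> {1..N}" using N by simp
  have cont: "f i (endpoint G (hub i)) = v" if i: "i \<in> {1..N}" for i
  proof -
    have "endpoint_value G f (hub i) = endpoint_value G f (hub 1)"
      using dom Nv hubs[OF i] hubs[OF one] unfolding laplacian_domain_def by blast
    then show ?thesis
      by (simp add: endpoint_value_def edge_of_hub[OF i] edge_of_hub[OF one] v_def del: One_nat_def)
  qed
  have Av: "A i = v / of_real (cos (phase l \<alpha> k i))" if i: "i \<in> {1..N}" for i
    using cont[OF i] fA[OF i ends_in_edge(2)[OF i]] mode_hub[OF i] c[OF i] by (simp add: field_simps)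
  have feq: "f = graph_fun_scale v (star_mode \<alpha> k)"
  proof (intro ext)
    fix i x
    show "f i x = graph_fun_scale v (star_mode \<alpha> k) i x"
    proof (cases "i \<in> {1..N} \<and> x \<in> edge G i")
      case True
      then show ?thesis using fA[of i x] Av[of i] by (simp add: graph_fun_scale_def star_mode_def)
    next
      case False
      have "f i x = 0"
        using dom False num_edges unfolding laplacian_domain_def W22_def by blast
      then show ?thesis using False by (auto simp: graph_fun_scale_def star_mode_def)
    qed
  qed
  have nd: "normal_deriv G f (hub i) = of_real k * v * of_real (tan (phase l \<alpha> k i))" if i: "i \<in> {1..N}" for i
  proof -
    have "edge_deriv G f i (endpoint G (hub i)) = A i * of_real (mode' \<alpha> k i (endpoint G (hub i)))"
      by (rule edge_deriv_eq[where f = f, OF i _ ends_in_edge(2)[OF i] mode_deriv[OF i]]) (rule fA[OF i])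
    then have "normal_deriv G f (hub i) = - (A i * of_real (dir i * mode' \<alpha> k i (endpoint G (hub i))))"
      by (simp only: normal_deriv_def edge_of_hub[OF i] dir_hub[OF i]) (simp add: algebra_simps)
    then show ?thesis by (simp add: mode'_hub[OF i] Av[OF i] tan_def)
  qed
  have "(\<Sum>i'\<in>vertex G (N + 1). normal_deriv G f i') = of_real (\<alpha> (N + 1)) * endpoint_value G f (hub 1)"
    using dom Nv hubs[OF one] unfolding laplacian_domain_def by blast
  moreover have "endpoint_value G f (hub 1) = v"
    by (simp add: endpoint_value_def edge_of_hub[OF one] v_def del: One_nat_def)
  moreover have "(\<Sum>i'\<in>vertex G (N + 1). normal_deriv G f i')
      = of_real k * v * of_real (\<Sum>i=1..N. tan (phase l \<alpha> k i))"
    unfolding vertex_hub by (simp add: sum.reindex[OF inj_hub] nd sum_distrib_left del: One_nat_def)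
  ultimately have "of_real k * v * of_real (\<Sum>i=1..N. tan (phase l \<alpha> k i)) = of_real (\<alpha> (N + 1)) * v"
    by (simp only:)
  then have "v * of_real (k * (\<Sum>i=1..N. tan (phase l \<alpha> k i))) = v * of_real (\<alpha> (N + 1))"
    by (simp only: of_real_mult mult_ac)
  then have "v = 0 \<or> k * (\<Sum>i=1..N. tan (phase l \<alpha> k i)) = \<alpha> (N + 1)"
    by (metis mult_left_cancel of_real_eq_iff)
  then have "secular_solution N l \<alpha> k \<or> v = 0"
    using k by (auto simp: secular_solution_def field_simps)
  with feq show ?thesis by blast
qed

text \<open>
The case \<open>v = 0\<close> is included because the zero function, too, is needed as an element of the
eigenspace: against it, a standing wave disproves uniqueness of solutions.
\<close>

lemma scaled_star_mode_in_eigenspace: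
  assumes k: "k > 0" and c: "\<And>i. i \<in> {1..N} \<Longrightarrow> cos (phase l \<alpha> k i) \<noteq> 0"
    and sec: "secular_solution N l \<alpha> k"
  shows "graph_fun_scale v (star_mode \<alpha> k) \<in> eigenspace (laplacian G \<alpha>) (of_real (k\<^sup>2))"
proof -
  define f where "f = graph_fun_scale v (star_mode \<alpha> k)"
  define A where "A i = v / of_real (cos (phase l \<alpha> k i))" for i
  have fA: "f i x = A i * of_real (mode \<alpha> k i x)" if "i \<in> {1..N}" "x \<in> edge G i" for i x
    using that by (simp add: f_def A_def graph_fun_scale_def star_mode_def)
  have D: "edge_deriv G f i y = A i * of_real (mode' \<alpha> k i y)" if i: "i \<in> {1..N}" and y: "y \<in> edge G i" for i y
    by (rule edge_deriv_eq[where f = f, OF i _ y mode_deriv[OF i]]) (rule fA[OF i])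
  have cont: "continuous_on S (\<lambda>x. A i * of_real (mode \<alpha> k i x))" for S i
    unfolding mode_def by (intro continuous_intros)
  have cont_f: "continuous_on (edge G i) (f i)" if i: "i \<in> {1..N}" for i
    using continuous_on_cong[OF refl, of "edge G i" "f i" "\<lambda>x. A i * of_real (mode \<alpha> k i x)"] fA[OF i] cont
    by blast
  have sd: "has_second_deriv G f (\<lambda>j x. - (of_real (k\<^sup>2) * f j x))"
    unfolding has_second_deriv_def
  proof (intro conjI ballI)
    show "(\<lambda>j x. - (of_real (k\<^sup>2) * f j x)) \<in> L2 G"
      unfolding L2_def num_edges
    proof (intro CollectI ballI conjI)
      fix i assume i: "i \<in> {1..N}"
      have "continuous_on (edge G i) (\<lambda>x. - (of_real (k\<^sup>2) * f i x))"
        using cont_f[OF i] by (intro continuous_intros)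
      then show "(\<lambda>x. - (of_real (k\<^sup>2) * f i x)) \<in> borel_measurable (lebesgue_on (edge G i))"
        by (rule continuous_imp_measurable_on_sets_lebesgue) (simp add: edge_def)
      have "continuous_on (edge G i) (\<lambda>x. (cmod (- (of_real (k\<^sup>2) * f i x)))\<^sup>2)"
        using cont_f[OF i] by (intro continuous_intros)
      then show "integrable (lebesgue_on (edge G i)) (\<lambda>x. (cmod (- (of_real (k\<^sup>2) * f i x)))\<^sup>2)"
        unfolding edge_def by (rule continuous_imp_integrable_real)
    qed
    fix i assume "i \<in> {1..num_edges G}"
    then have i: "i \<in> {1..N}" by (simp add: num_edges)
    show "f i differentiable_on edge G i"
      unfolding differentiable_on_def
    proof
      fix x assume x: "x \<in> edge G i"
      show "f i differentiable at x within edge G i"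
        using has_vector_derivative_transform[OF x fA[OF i] mode_deriv[OF i]]
        by (rule differentiableI_vector)
    qed
    fix x assume x: "x \<in> edge G i"
    define a where "a = endpoint G (2 * i - 1)"
    have ax: "a \<le> x" "{a..x} \<subseteq> edge G i" "a \<in> edge G i"
      using x by (auto simp: edge_def a_def)
    have "((\<lambda>t. A i * of_real (- (k\<^sup>2 * mode \<alpha> k i t))) has_integral
        (A i * of_real (mode' \<alpha> k i x) - A i * of_real (mode' \<alpha> k i a))) {a..x}"
      by (rule fundamental_theorem_of_calculus[OF ax(1)]) (rule mode'_deriv[OF i])
    then have "((\<lambda>t. A i * of_real (- (k\<^sup>2 * mode \<alpha> k i t))) has_integral
        (edge_deriv G f i x - edge_deriv G f i a)) {a..x}"
      by (simp only: D[OF i x] D[OF i ax(3)])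
    then show "((\<lambda>x. - (of_real (k\<^sup>2) * f i x)) has_integral
        (edge_deriv G f i x - edge_deriv G f i (endpoint G (2 * i - 1)))) {endpoint G (2 * i - 1)..x}"
      unfolding a_def[symmetric]
      by (rule has_integral_eq[rotated]) (use ax(2) fA[OF i] in \<open>auto simp: mult_ac\<close>)
  qed
  have W: "f \<in> W22 G"
    using sd unfolding W22_def
    by (auto simp: f_def graph_fun_scale_def star_mode_def num_edges split: if_splits)
  have value_hub: "endpoint_value G f (hub i) = v" if i: "i \<in> {1..N}" for i
    unfolding endpoint_value_def edge_of_hub[OF i] fA[OF i ends_in_edge(2)[OF i]] mode_hub[OF i] A_def
    using c[OF i] by simp
  have nd_hub: "normal_deriv G f (hub i) = of_real k * v * of_real (tan (phase l \<alpha> k i))" if i: "i \<in> {1..N}" for i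
  proof -
    have "normal_deriv G f (hub i) = - (A i * of_real (dir i * mode' \<alpha> k i (endpoint G (hub i))))"
      by (simp only: normal_deriv_def edge_of_hub[OF i] dir_hub[OF i] D[OF i ends_in_edge(2)[OF i]])
         (simp add: algebra_simps)
    then show ?thesis by (simp add: mode'_hub[OF i] A_def tan_def)
  qed
  have nd_leaf: "normal_deriv G f (leaf i) = of_real (\<alpha> i) * endpoint_value G f (leaf i)" if i: "i \<in> {1..N}" for i
  proof -
    have "normal_deriv G f (leaf i) = A i * of_real (dir i * mode' \<alpha> k i (endpoint G (leaf i)))"
      by (simp only: normal_deriv_def edge_of_leaf[OF i] dir_leaf[OF i] D[OF i ends_in_edge(1)[OF i]])
         (simp add: algebra_simps)
    moreover have "endpoint_value G f (leaf i) = A i * of_real (mode \<alpha> k i (endpoint G (leaf i)))"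
      by (simp only: endpoint_value_def edge_of_leaf[OF i] fA[OF i ends_in_edge(1)[OF i]])
    ultimately show ?thesis using k by (simp add: mode'_leaf[OF i] mode_leaf[OF i])
  qed
  have "(\<Sum>i'\<in>vertex G (N + 1). normal_deriv G f i')
      = of_real k * v * of_real (\<Sum>i=1..N. tan (phase l \<alpha> k i))"
    unfolding vertex_hub by (simp add: sum.reindex[OF inj_hub] nd_hub sum_distrib_left del: One_nat_def)
  also have "\<dots> = of_real (\<alpha> (N + 1)) * v"
    using sec k by (simp add: secular_solution_def)
  finally have sum_hub: "(\<Sum>i'\<in>vertex G (N + 1). normal_deriv G f i') = of_real (\<alpha> (N + 1)) * v" .
  have "f \<in> laplacian_domain G \<alpha>"
    unfolding laplacian_domain_def
  proof (intro CollectI conjI[OF W] ballI)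
    fix j assume "j \<in> {1..num_verts G}"
    then consider "j \<in> {1..N}" | "j = N + 1" using num_verts by fastforce
    then show "(\<forall>i\<in>vertex G j. \<forall>i'\<in>vertex G j. endpoint_value G f i = endpoint_value G f i') \<and>
        (\<forall>i\<in>vertex G j. (\<Sum>i'\<in>vertex G j. normal_deriv G f i') = of_real (\<alpha> j) * endpoint_value G f i)"
    proof cases
      case 1
      then show ?thesis using nd_leaf by (simp add: vertex_leaf)
    next
      case 2
      then show ?thesis using sum_hub value_hub unfolding 2 vertex_hub by auto
    qed
  qed
  with sd show ?thesis
    by (simp add: eigenspace_def laplacian_def f_def graph_fun_scale_def)
qed

lemma star_mode_nonzero:
  assumes c: "\<And>i. i \<in> {1..N} \<Longrightarrow> cos (phase l \<alpha> k i) \<noteq> 0" and N: "N \<ge> 1"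
  shows "star_mode \<alpha> k \<noteq> 0"
proof
  assume 0: "star_mode \<alpha> k = 0"
  have 1: "1 \<in> {1..N}" using N by simp
  have "star_mode \<alpha> k 1 (endpoint G (hub 1)) = 1"
    using c[OF 1] ends_in_edge(2)[OF 1] 1 by (simp add: star_mode_def mode_hub[OF 1] del: One_nat_def)
  then show False by (simp add: 0)
qed

interpretation gf: vector_space graph_fun_scale by (rule vector_space_graph_fun)

text \<open>
The eigenvalue destroys the uniqueness of solutions of \<open>(A - k\<^sup>2) f = 0\<close>, so it belongs to the
spectrum.
\<close>

lemma spectrum_of_secular_solution:
  assumes k: "k > 0" and N: "N \<ge> 1" and c: "\<And>i. i \<in> {1..N} \<Longrightarrow> cos (phase l \<alpha> k i) \<noteq> 0"
    and sec: "secular_solution N l \<alpha> k"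
  shows "of_real (k\<^sup>2) \<in> spectrum G (laplacian G \<alpha>)"
    and "multiplicity (laplacian G \<alpha>) (of_real (k\<^sup>2)) = 1"
proof -
  let ?E = "eigenspace (laplacian G \<alpha>) (of_real (k\<^sup>2))" and ?\<phi> = "star_mode \<alpha> k"
  note mem = scaled_star_mode_in_eigenspace[OF k c sec]
  have E: "?\<phi> \<in> ?E" "0 \<in> ?E" using mem[of 1] mem[of 0] by (simp_all add: gf.scale_one)
  show "multiplicity (laplacian G \<alpha>) (of_real (k\<^sup>2)) = 1"
    unfolding multiplicity_def
  proof (rule gf.dim_unique[of "{?\<phi>}"])
    show "?E \<subseteq> gf.span {?\<phi>}"
    proof
      fix f assume "f \<in> ?E"
      from eigenfunction_eq_scaled_star_mode[OF this k N c]
      obtain v where "f = graph_fun_scale v ?\<phi>" by blast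
      then show "f \<in> gf.span {?\<phi>}" by (simp add: gf.span_scale gf.span_base)
    qed
    show "gf.independent {?\<phi>}"
      using star_mode_nonzero[OF c N] by (simp add: gf.dependent_single)
  qed (use E in auto)
  have "(\<lambda>j x. 0) \<in> L2 G" by (simp add: L2_def)
  moreover have "\<not> (\<exists>!f. (f, \<lambda>j x. of_real (k\<^sup>2) * f j x + 0) \<in> laplacian G \<alpha>)"
  proof
    assume ex1: "\<exists>!f. (f, \<lambda>j x. of_real (k\<^sup>2) * f j x + 0) \<in> laplacian G \<alpha>"
    have "(f, \<lambda>j x. of_real (k\<^sup>2) * f j x + 0) \<in> laplacian G \<alpha>" if "f \<in> ?E" for f
      using that by (simp only: eigenspace_def graph_fun_scale_def mem_Collect_eq add_0_right)
    then have "?\<phi> = 0" using ex1 E by blast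
    with star_mode_nonzero[OF c N] show False by simp
  qed
  ultimately have "of_real (k\<^sup>2) \<notin> resolvent_set G (laplacian G \<alpha>)"
    unfolding resolvent_set_def mem_Collect_eq by fast
  then show "of_real (k\<^sup>2) \<in> spectrum G (laplacian G \<alpha>)"
    by (simp only: spectrum_def Compl_iff not_False_eq_True)
qed

lemma secular_solution_of_multiplicity:
  assumes k: "k > 0" and N: "N \<ge> 1" and c: "\<And>i. i \<in> {1..N} \<Longrightarrow> cos (phase l \<alpha> k i) \<noteq> 0"
    and m: "multiplicity (laplacian G \<alpha>) (of_real (k\<^sup>2)) \<noteq> 0"
  shows "secular_solution N l \<alpha> k"
proof (rule ccontr)
  let ?E = "eigenspace (laplacian G \<alpha>) (of_real (k\<^sup>2))"
  assume "\<not> secular_solution N l \<alpha> k"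
  have "?E \<subseteq> gf.span {}"
  proof
    fix f assume "f \<in> ?E"
    from eigenfunction_eq_scaled_star_mode[OF this k N c] \<open>\<not> secular_solution N l \<alpha> k\<close>
    have "f = graph_fun_scale 0 (star_mode \<alpha> k)" by blast
    then show "f \<in> gf.span {}" by (simp only: gf.scale_zero_left gf.span_zero)
  qed
  then have "gf.dim ?E \<le> card ({} :: graph_fun set)" by (rule gf.dim_le_card) simp
  with m show False by (simp add: multiplicity_def)
qed

text \<open>
It is the equality of the multiplicities that carries an eigenvalue of the first operator over to
the second one: a point of the spectrum with multiplicity 1 has an eigenfunction.
\<close>

lemma isospectral_shares_secular_solutions:
  assumes N: "N \<ge> 1" and iso: "isospectral G (laplacian G \<alpha>) (laplacian G \<alpha>')"
  shows "shares_secular_solutions N l \<alpha> \<alpha>'"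
  unfolding shares_secular_solutions_def
proof (intro allI impI)
  fix k :: real
  assume k: "k > 0" and c: "\<forall>j\<in>{1..N}. cos (phase l \<alpha> k j) \<noteq> 0 \<and> cos (phase l \<alpha>' k j) \<noteq> 0"
    and sec: "secular_solution N l \<alpha> k"
  have "of_real (k\<^sup>2) \<in> spectrum G (laplacian G \<alpha>)"
    "multiplicity (laplacian G \<alpha>) (of_real (k\<^sup>2)) = 1"
    using spectrum_of_secular_solution[OF k N _ sec] c by blast+
  then have "multiplicity (laplacian G \<alpha>') (of_real (k\<^sup>2)) = 1"
    using iso by (simp add: isospectral_def)
  then show "secular_solution N l \<alpha>' k"
    using c by (intro secular_solution_of_multiplicity[OF k N]) auto
qed

end

text \<open>
A boundary vertex has valence at most 1, so it consists of one end of its edge; the other ends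
are then exactly the members of the central vertex.
\<close>

lemma star_graph_imp_delta_star:
  assumes "star_graph N l G"
  obtains leaf hub where "delta_star G N l leaf hub"
proof -
  note sg = assms[unfolded star_graph_def]
  note cmg = sg[THEN conjunct1] and ne = sg[THEN conjunct2, THEN conjunct1]
    and nv = sg[THEN conjunct2, THEN conjunct2, THEN conjunct1]
    and int = sg[THEN conjunct2, THEN conjunct2, THEN conjunct2, THEN conjunct1]
    and edges = sg[THEN conjunct2, THEN conjunct2, THEN conjunct2, THEN conjunct2]
  have len: "edge_length G i = l i" and joins: "edge_joins G i i (N + 1)" if "i \<in> {1..N}" for i
    using bspec[OF edges that] by blast+
  note cmg' = cmg[unfolded compact_metric_graph_def ne nv]
  note lt = cmg'[THEN conjunct1] and part = cmg'[THEN conjunct2, THEN conjunct1]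
    and inj = cmg'[THEN conjunct2, THEN conjunct2]
  define leaf where "leaf i = (if 2 * i - 1 \<in> vertex G i \<and> 2 * i \<in> vertex G (N + 1) then 2 * i - 1 else 2 * i)" for i
  define hub where "hub i = (if 2 * i - 1 \<in> vertex G i \<and> 2 * i \<in> vertex G (N + 1) then 2 * i else 2 * i - 1)" for i
  have mem: "leaf i \<in> vertex G i" "hub i \<in> vertex G (N + 1)" if "i \<in> {1..N}" for i
    using joins[OF that] by (auto simp: edge_joins_def leaf_def hub_def)
  have sub: "vertex G i \<subseteq> {1..2 * N}" if "i \<in> {1..N + 1}" for i
    using partition_onD1[OF part] that by blast
  have vleaf: "vertex G i = {leaf i}" if i: "i \<in> {1..N}" for i
  proof -
    have i': "i \<in> {1..N + 1}" "i \<noteq> N + 1" using i by auto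
    have "card (vertex G i) \<le> 1" using bspec[OF int i'(1)] i'(2) by (simp add: internal_vertex_def valence_def)
    moreover have "finite (vertex G i)" using sub[OF i'(1)] finite_subset by blast
    ultimately show ?thesis using mem(1)[OF i] card_le_Suc0_iff_eq[of "vertex G i"] by auto
  qed
  have vhub: "vertex G (N + 1) = hub ` {1..N}"
  proof
    show "hub ` {1..N} \<subseteq> vertex G (N + 1)" using mem(2) by blast
    show "vertex G (N + 1) \<subseteq> hub ` {1..N}"
    proof
      fix x assume x: "x \<in> vertex G (N + 1)"
      define i where "i = (x + 1) div 2"
      have x2: "x \<in> {1..2 * N}" using sub[of "N + 1"] x by auto
      then have i: "i \<in> {1..N}" and xi: "x = 2 * i - 1 \<or> x = 2 * i" unfolding i_def by auto
      have "vertex G i \<noteq> vertex G (N + 1)" using inj_onD[OF inj, of i "N + 1"] i by auto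
      then have "vertex G i \<inter> vertex G (N + 1) = {}"
        using partition_onD2[OF part] i by (auto simp: disjoint_def)
      then have "x \<noteq> leaf i" using mem(1)[OF i] x by auto
      then have "x = hub i" using xi by (auto simp: leaf_def hub_def split: if_splits)
      then show "x \<in> hub ` {1..N}" using i by blast
    qed
  qed
  have "delta_star G N l leaf hub"
  proof
    fix i assume i: "i \<in> {1..N}"
    show "leaf i = 2 * i - 1 \<and> hub i = 2 * i \<or> leaf i = 2 * i \<and> hub i = 2 * i - 1"
      by (simp add: leaf_def hub_def)
    show "endpoint G (2 * i) = endpoint G (2 * i - 1) + l i" "l i > 0"
      using len[OF i] bspec[OF lt i] by (simp_all add: edge_length_def)
  qed (use ne nv vleaf vhub in auto)
  then show thesis by (rule that)
qed

section \<open>Recovering the coupling constants\<close>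

theorem theorem5p1:
  fixes N :: nat and l :: "nat \<Rightarrow> real" and G :: metric_graph
    and \<alpha> \<alpha>' :: "nat \<Rightarrow> real"
  assumes "N \<ge> 2"
    and "star_graph N l G"
    and "rationally_independent {1..N} l"
    and "N = 2 \<Longrightarrow> \<alpha> (N + 1) \<noteq> 0 \<and> \<alpha>' (N + 1) \<noteq> 0"
    and "isospectral G (laplacian G \<alpha>) (laplacian G \<alpha>')"
  shows "\<forall>k\<in>{1..N + 1}. \<alpha> k = \<alpha>' k"
proof -
  obtain leaf hub where "delta_star G N l leaf hub"
    by (rule star_graph_imp_delta_star[OF assms(2)])
  then interpret delta_star G N l leaf hub .
  have "shares_secular_solutions N l \<alpha> \<alpha>'"
    by (rule isospectral_shares_secular_solutions) (use assms in auto)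
  then show ?thesis
    using couplings_determined_by_secular_solutions[OF assms(1,3) length_pos] assms(4) by blast
qed

end
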